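(* Let $\mathcal{A}$ be a finite-dimensional descendingly flexible algebra over an arbitrary field $\mathbb{F}$, and let $n = l(\mathcal{A})$ be its length. Then $$\dim \mathcal{A} - d_0 \geq \begin{cases} n, & 1 \leq n \leq 2,\\ 2n - 1, & 3 \leq n \leq 5,\\ 3 \cdot 2^{n-4} + n - 3, & 6 \leq n.\end{cases}$$
   Context: $\mathcal{A}$ is a finite-dimensional algebra over a field $\mathbb{F}$ (a vector space with a bilinear product), possibly non-unital and non-associative. If $\mathcal{A}$ is unital, its unity is denoted by $e$. For $S \subseteq \mathcal{A}$ and $k\ge 1$, a word of length $k$ in $S$ is any product of $k$ elements of $S$, with any arrangement of brackets. If $\mathcal{A}$ is unital, $e$ is a word of length $0$; otherwise there are no words of length $0$. $S^k$ is the set of all words in $S$ of length at most $k$. $\mathcal{L}(X)$ denotes the linear span of $X$, $\mathcal{L}_k(S) = \mathcal{L}(S^k)$ for $k\ge 0$, and $\mathcal{L}_\infty(S) = \bigcup_{k\ge 0}\mathcal{L}_k(S)$. $S$ is generating for $\mathcal{A}$ if $\mathcal{L}_\infty(S)=\mathcal{A}$. The length of $S$ is $l(S) = \min\{k : \mathcal{L}_k(S)=\mathcal{L}_\infty(S)\}$, and the length of $\mathcal{A}$ is $l(\mathcal{A}) = \max\{l(S) : \mathcal{L}_\infty(S)=\mathcal{A}\}$. Set $d_0 = 1$ if $\mathcal{A}$ is unital, and $d_0 = 0$ otherwise. For $a,b,c\in\mathcal{A}$ let $\mathcal{L}'_2(a,b,c)$ be the span of $a,b,c,ab,ba,cb,bc,ac,ca$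 (together with $e$ if $\mathcal{A}$ is unital), and let $\mathcal{L}_1(a,b,aa,ab,ba)$ be the span of $a,b,aa,ab,ba$ (together with $e$ if $\mathcal{A}$ is unital). $\mathcal{A}$ is descendingly flexible if for all $a,b,c\in\mathcal{A}$: $(ab)a,\ a(ba) \in \mathcal{L}_1(a,b,aa,ab,ba)$; $(ab)c+(cb)a\in\mathcal{L}'_2(a,b,c)$; and $a(bc)+c(ba)\in\mathcal{L}'_2(a,b,c)$. *)

theory Defs
  imports Complex_Main
begin

locale nonassoc_algebra = vector_space scale
  for scale :: "'f::field \<Rightarrow> 'a::ab_group_add \<Rightarrow> 'a" (infixr "*s" 75) +
  fixes mult :: "'a \<Rightarrow> 'a \<Rightarrow> 'a" (infixl "\<cdot>" 70)
  assumes mult_add_left: "(a + b) \<cdot> c = a \<cdot> c + b \<cdot> c"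
    and mult_add_right: "a \<cdot> (b + c) = a \<cdot> b + a \<cdot> c"
    and mult_scale_left: "(r *s a) \<cdot> b = r *s (a \<cdot> b)"
    and mult_scale_right: "a \<cdot> (r *s b) = r *s (a \<cdot> b)"
begin

(* The set of two-sided unities: the singleton of the unity if the algebra is unital,
   and empty otherwise. *)
definition unity :: "'a set" where
  "unity = {e. \<forall>a. e \<cdot> a = a \<and> a \<cdot> e = a}"

definition unital :: bool where
  "unital \<longleftrightarrow> unity \<noteq> {}"

definition d0 :: nat where
  "d0 = (if unital then 1 else 0)"

(* word S k w: w is the value of some bracketed product of k factors from S. *)
inductive word :: "'a set \<Rightarrow> nat \<Rightarrow> 'a \<Rightarrow> bool" for S where
  word_unity: "e \<in> unity \<Longrightarrow> word S 0 e"
| word_generator: "s \<in> S \<Longrightarrow> word S 1 s"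
| word_mult: "\<lbrakk>word S i u; word S j v; 1 \<le> i; 1 \<le> j\<rbrakk> \<Longrightarrow> word S (i + j) (u \<cdot> v)"

definition words_upto :: "'a set \<Rightarrow> nat \<Rightarrow> 'a set" where
  "words_upto S k = {w. \<exists>i\<le>k. word S i w}"

definition \<L> :: "nat \<Rightarrow> 'a set \<Rightarrow> 'a set" where
  "\<L> k S = span (words_upto S k)"

definition \<L>_inf :: "'a set \<Rightarrow> 'a set" where
  "\<L>_inf S = (\<Union>k. \<L> k S)"

definition generating :: "'a set \<Rightarrow> bool" where
  "generating S \<longleftrightarrow> \<L>_inf S = UNIV"

definition set_length :: "'a set \<Rightarrow> nat" where
  "set_length S = (LEAST k. \<L> k S = \<L>_inf S)"

(* In finite dimension the set below is finite and nonempty, so the maximum exists;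
   see finite_set_lengths and set_lengths_nonempty. *)
definition alg_length :: nat where
  "alg_length = Max (set_length ` {S. generating S})"

definition \<L>2' :: "'a \<Rightarrow> 'a \<Rightarrow> 'a \<Rightarrow> 'a set" where
  "\<L>2' a b c = span ({a, b, c, a \<cdot> b, b \<cdot> a, c \<cdot> b, b \<cdot> c, a \<cdot> c, c \<cdot> a} \<union> unity)"

definition descendingly_flexible :: bool where
  "descendingly_flexible \<longleftrightarrow>
     (\<forall>a b c.
        (a \<cdot> b) \<cdot> a \<in> \<L> 1 {a, b, a \<cdot> a, a \<cdot> b, b \<cdot> a} \<and>
        a \<cdot> (b \<cdot> a) \<in> \<L> 1 {a, b, a \<cdot> a, a \<cdot> b, b \<cdot> a} \<and>
        (a \<cdot> b) \<cdot> c + (c \<cdot> b) \<cdot> a \<in> \<L>2' a b c \<and>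
        a \<cdot> (b \<cdot> c) + c \<cdot> (b \<cdot> a) \<in> \<L>2' a b c)"

lemma words_upto_1: "words_upto S 1 = S \<union> unity"
proof -
  have "word S i w \<Longrightarrow> i \<le> 1 \<Longrightarrow> w \<in> S \<union> unity" for i w
    by (induction rule: word.induct) auto
  moreover have "word S 0 e" if "e \<in> unity" for e using that by (rule word_unity)
  moreover have "word S 1 s" if "s \<in> S" for s using that by (rule word_generator)
  ultimately show ?thesis
    unfolding words_upto_def by (blast intro: zero_le)
qed

lemma \<L>_1: "\<L> 1 S = span (S \<union> unity)"
  by (simp only: \<L>_def words_upto_1)

lemma unity_unique: "e \<in> unity \<Longrightarrow> e' \<in> unity \<Longrightarrow> e = e'"
proof -
  assume "e \<in> unity" "e' \<in> unity"
  then have "e \<cdot> e' = e'" "e \<cdot> e' = e"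
    unfolding unity_def by blast+
  then show ?thesis by simp
qed

lemma \<L>_mono: "i \<le> j \<Longrightarrow> \<L> i S \<subseteq> \<L> j S"
  unfolding \<L>_def words_upto_def by (intro span_mono Collect_mono) (meson order_trans)

lemma word_in_\<L>: "word S i w \<Longrightarrow> i \<le> k \<Longrightarrow> w \<in> \<L> k S"
  unfolding \<L>_def words_upto_def by (intro span_base) auto

lemma words_mult:
  assumes "word S i u" "word S j v"
  shows "word S (i + j) (u \<cdot> v)"
proof -
  have z: "w \<in> unity" if "word S 0 w" for w
    using that by (cases) auto
  consider "i = 0" | "j = 0" | "1 \<le> i" "1 \<le> j" by linarith
  then show ?thesis
  proof cases
    case 1
    then have "u \<cdot> v = v" using z assms unfolding unity_def by blast
    then show ?thesis using 1 assms by simp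
  next
    case 2
    then have "u \<cdot> v = u" using z assms unfolding unity_def by blast
    then show ?thesis using 2 assms by simp
  next
    case 3
    then show ?thesis by (rule word_mult[OF assms])
  qed
qed

lemma mult_span:
  assumes "x \<in> span X" "y \<in> span Y" "\<And>u v. u \<in> X \<Longrightarrow> v \<in> Y \<Longrightarrow> u \<cdot> v \<in> span Z"
  shows "x \<cdot> y \<in> span Z"
proof -
  have zl: "0 \<cdot> c = 0" and zr: "c \<cdot> 0 = 0" for c
    using mult_add_left[of 0 0 c] mult_add_right[of c 0 0] by auto
  have 1: "u \<cdot> y \<in> span Z" if "u \<in> X" for u
    using assms(2)
    by (induction rule: span_induct_alt)
       (simp_all add: zr mult_add_right mult_scale_right assms(3)[OF that] span_zero
          span_add span_scale)
  show ?thesis using assms(1)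
    by (induction rule: span_induct_alt)
       (simp_all add: zl mult_add_left mult_scale_left 1 span_zero span_add span_scale)
qed

lemma \<L>_mult: "x \<in> \<L> i S \<Longrightarrow> y \<in> \<L> j S \<Longrightarrow> x \<cdot> y \<in> \<L> (i + j) S"
  unfolding \<L>_def
proof (erule mult_span, assumption)
  fix u v assume "u \<in> words_upto S i" "v \<in> words_upto S j"
  then obtain i' j' where "i' \<le> i" "j' \<le> j" "word S i' u" "word S j' v"
    unfolding words_upto_def by blast
  then have "i' + j' \<le> i + j" "word S (i' + j') (u \<cdot> v)"
    by (auto intro: words_mult)
  then show "u \<cdot> v \<in> span (words_upto S (i + j))"
    unfolding words_upto_def by (intro span_base) blast
qed

lemma \<L>_stable:
  assumes "\<L> (2 * k) S = \<L> k S" "1 \<le> k"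
  shows "\<L>_inf S = \<L> k S"
proof -
  have "w \<in> \<L> k S" if "word S i w" for i w
    using that
  proof induction
    case (word_mult i u j v)
    then show ?case using \<L>_mult[of u k S v k] assms by (simp add: mult_2)
  next
    case (word_unity e)
    then show ?case using word_in_\<L>[OF word.word_unity] by blast
  next
    case (word_generator s)
    then show ?case using word_in_\<L>[OF word.word_generator] assms(2) by blast
  qed
  then have "\<L> i S \<subseteq> \<L> k S" for i
    unfolding \<L>_def[of i] words_upto_def
    by (intro span_minimal) (auto simp: \<L>_def)
  then show ?thesis unfolding \<L>_inf_def by blast
qed

lemma generating_UNIV: "generating UNIV"
  using word_in_\<L>[OF word_generator, of _ UNIV 1]
  unfolding generating_def \<L>_inf_def by auto

lemma set_lengths_nonempty: "set_length ` {S. generating S} \<noteq> {}"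
  using generating_UNIV by blast

end

locale fin_dim_nonassoc_algebra =
  nonassoc_algebra scale mult + finite_dimensional_vector_space scale Basis
  for scale :: "'f::field \<Rightarrow> 'a::ab_group_add \<Rightarrow> 'a" (infixr "*s" 75)
    and mult :: "'a \<Rightarrow> 'a \<Rightarrow> 'a" (infixl "\<cdot>" 70)
    and Basis :: "'a set"
begin

lemma \<L>_attained: "\<exists>k \<le> 2 ^ dimension. \<L> k S = \<L>_inf S"
proof (rule ccontr)
  assume neg: "\<not> ?thesis"
  have "j \<le> dim (\<L> (2 ^ j) S)" if "j \<le> Suc dimension" for j
    using that
  proof (induction j)
    case (Suc j)
    have le: "(2::nat) ^ j \<le> 2 ^ dimension"
      using Suc.prems by (intro power_increasing) auto
    then have "\<L> (2 ^ j) S \<noteq> \<L>_inf S"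
      using neg by blast
    then have ne: "\<L> (2 * 2 ^ j) S \<noteq> \<L> (2 ^ j) S"
      using \<L>_stable[of "2 ^ j" S] by auto
    have "dim (\<L> (2 ^ j) S) < dim (\<L> (2 * 2 ^ j) S)"
    proof (rule dim_psubset)
      have sp: "span (\<L> i S) = \<L> i S" for i
        unfolding \<L>_def by (rule span_span)
      show "span (\<L> (2 ^ j) S) \<subset> span (\<L> (2 * 2 ^ j) S)"
        using ne \<L>_mono[of "2 ^ j" "2 * 2 ^ j" S] unfolding sp by auto
    qed
    then show ?case using Suc by simp
  qed simp
  from this[of "Suc dimension"] dim_subset_UNIV[of "\<L> (2 ^ Suc dimension) S"]
  show False by simp
qed

lemma \<L>_set_length: "\<L> (set_length S) S = \<L>_inf S"
  unfolding set_length_def by (rule LeastI_ex) (use \<L>_attained in blast)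

lemma finite_set_lengths: "finite (set_length ` {S. generating S})"
proof (rule finite_subset)
  have "set_length S \<le> 2 ^ dimension" for S
    using \<L>_attained[of S] unfolding set_length_def by (meson Least_le order_trans)
  then show "set_length ` {S. generating S} \<subseteq> {..2 ^ dimension}" by auto
qed simp

end

end

theory Submission
  imports Defs "HOL-Library.Multiset"
begin

text \<open>
  Modulo products of lower degree, descending flexibility says \<open>(xy)z = -(zy)x\<close>,
  \<open>x(yz) = -z(yx)\<close> and \<open>(xy)x = x(yx) = 0\<close>. Label every leaf of a bracketing by the number of right
  turns minus the number of left turns on its path from the root, modulo 3. Both exchanges only
  permute leaves with equal labels, and conversely any two bracketings with the same labelled
  leaves are connected by exchanges. So, up to sign and lower terms, the value of a bracketing
  depends only on its labelled leaves, and apart from one degenerate pattern it drops degree as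
  soon as a leaf is repeated with the same label.

  Let \<open>n\<close> be the length of a generating set and fix a word of length \<open>n\<close> that is not a
  combination of shorter ones, with its \<open>n\<close> labelled leaves. For a set \<open>I\<close> of \<open>m\<close> of these leaves
  that is realized by a bracketing with root label \<open>v\<close>, the complement together with a hole
  labelled \<open>v\<close> is realized by a linear map raising degrees by \<open>n - m\<close>. Such a map for \<open>I\<close>
  does not annihilate the element of \<open>I\<close>, but annihilates that of any other \<open>m\<close>-set \<open>J\<close>, because
  some leaf is then repeated. Hence \<open>dim \<L>\<^sub>m - dim \<L>\<^sub>m\<^sub>-\<^sub>1\<close> is at least the number of such sets.
  Realizability is a parity condition satisfied by \<open>2 ^ (n - 2)\<close> of all sets of leaves; if \<open>k \<le> n - 4\<close>
  leaves carry the label of the root, then at most \<open>2 ^ k - k - 1\<close> of them are lost to degenerate cases,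
  and \<open>2 ^ (n - 2) - (2 ^ (n - 4) - (n - 4) - 1)\<close> is the bound for \<open>n \<ge> 6\<close>. Otherwise \<open>k = n - 2\<close>,
  and the sets made up of root-labelled leaves and one fixed further leaf suffice.
\<close>

section \<open>Bracketings and their leaf labels\<close>

datatype 'b tree = Leaf 'b | Node "'b tree" "'b tree"

text \<open>Residues modulo 3: \<open>nx\<close> adds one, so \<open>nx (nx v)\<close> also serves
  as \<open>v\<close> minus one, the label one left turn below \<open>v\<close>.\<close>

datatype z3 = Z0 | Z1 | Z2

fun nx :: "z3 \<Rightarrow> z3" where
  "nx Z0 = Z1"
| "nx Z1 = Z2"
| "nx Z2 = Z0"

lemma nx_nx_nx [simp]: "nx (nx (nx v)) = v"
  by (cases v) auto

lemma nx_neq [simp]: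
  "nx v \<noteq> v" "v \<noteq> nx v" "nx (nx v) \<noteq> v" "v \<noteq> nx (nx v)"
  by (cases v; simp)+

lemma nx_eq_iff [simp]: "nx u = nx v \<longleftrightarrow> u = v"
  by (cases u; cases v) auto

lemma z3_cases: obtains "c = v" | "c = nx v" | "c = nx (nx v)"
  by (cases v; cases c) auto

fun deg :: "'b tree \<Rightarrow> nat" where
  "deg (Leaf x) = 1"
| "deg (Node l r) = deg l + deg r"

fun leaves :: "z3 \<Rightarrow> 'b tree \<Rightarrow> ('b \<times> z3) multiset" where
  "leaves v (Leaf x) = {#(x, v)#}"
| "leaves v (Node l r) = leaves (nx (nx v)) l + leaves (nx v) r"

lemma deg_pos [simp]: "0 < deg t"
  by (induction t) auto

lemma size_leaves [simp]: "size (leaves v t) = deg t"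
  by (induction t arbitrary: v) auto

lemma leaves_eq_single: "leaves v t = {#p#} \<Longrightarrow> t = Leaf (fst p)"
proof (cases t)
  case (Node l r)
  moreover assume "leaves v t = {#p#}"
  ultimately have "deg l + deg r = 1"
    by (metis size_leaves deg.simps(2) size_single)
  then show ?thesis using deg_pos[of l] deg_pos[of r] by linarith
qed auto

section \<open>Label counts and realizable multisets of labelled leaves\<close>

definition cnt :: "z3 \<Rightarrow> ('b \<times> z3) multiset \<Rightarrow> nat" where
  "cnt c M = size (filter_mset (\<lambda>p. snd p = c) M)"

lemma cnt_simps [simp]:
  "cnt c {#} = 0"
  "cnt c (add_mset p M) = (if snd p = c then Suc (cnt c M) else cnt c M)"
  "cnt c (M + N) = cnt c M + cnt c N"
  by (auto simp: cnt_def)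

lemma cnt_pos_iff: "0 < cnt c M \<longleftrightarrow> (\<exists>x. (x, c) \<in># M)"
proof (induction M)
  case (add p M)
  then show ?case by (cases p) auto
qed simp

lemma cnt_posE:
  assumes "0 < cnt c M"
  obtains x N where "M = add_mset (x, c) N"
  using assms unfolding cnt_pos_iff by (metis insert_DiffM)

lemma size_eq_cnt: "size M = cnt v M + cnt (nx v) M + cnt (nx (nx v)) M"
proof (induction M)
  case (add p M)
  then show ?case by (cases rule: z3_cases[of "snd p" v]) auto
qed simp

text \<open>Such multisets are exactly the labelled leaves of the bracketings with root label \<open>v\<close>,
  see \<open>adm_leaves\<close> and \<open>adm_realizable\<close>.\<close>

definition adm :: "z3 \<Rightarrow> ('b \<times> z3) multiset \<Rightarrow> bool" where
  "adm v M \<longleftrightarrow>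
     (even (cnt (nx v) M) \<longleftrightarrow> even (cnt (nx (nx v)) M)) \<and>
     (even (cnt v M) \<longleftrightarrow> odd (cnt (nx v) M)) \<and>
     (cnt (nx v) M = 0 \<and> cnt (nx (nx v)) M = 0 \<longrightarrow> cnt v M = 1)"

lemma adm_leaves: "adm v (leaves v t)"
proof (induction t arbitrary: v)
  case (Node l r)
  from Node.IH(1)[of "nx (nx v)"] Node.IH(2)[of "nx v"] show ?case
    unfolding adm_def by auto
qed (simp add: adm_def)

text \<open>Allows building a bracketing leaf by leaf. Removing a leaf of label \<open>nx v\<close>
  or \<open>nx (nx v)\<close> always leaves the right parities for the other child, so only the
  degenerate clause of \<open>adm\<close> decides which side works.\<close>

lemma adm_peel:
  assumes "adm v M" "size M \<noteq> 1"
  obtains (right) x N where "M = add_mset (x, nx v) N" "adm (nx (nx v)) N"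
  | (left) x N where "M = add_mset (x, nx (nx v)) N" "adm (nx v) N"
proof -
  let ?a = "cnt v M" and ?b = "cnt (nx v) M" and ?c = "cnt (nx (nx v)) M"
  have nz: "\<not> (?b = 0 \<and> ?c = 0)"
    using assms size_eq_cnt[of M v] unfolding adm_def by auto
  show ?thesis
  \<comment> \<open>Removal on the right meets the degenerate clause only if \<open>?a = 0\<close>,
    \<open>?b = 1\<close> and \<open>?c \<noteq> 1\<close>; then \<open>?c\<close> is odd and at
    least 3. If \<open>?b = 0\<close>, then \<open>?a\<close> is odd. Both times a left leaf can be
    removed.\<close>
  proof (cases "0 < ?b \<and> \<not> (?a = 0 \<and> ?b = 1 \<and> ?c \<noteq> 1)")
    case True
    then obtain x N where M: "M = add_mset (x, nx v) N" by (metis cnt_posE)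
    have "adm (nx (nx v)) N"
      using assms True unfolding M adm_def by auto
    with M show ?thesis by (rule right)
  next
    case False
    then have "0 < ?c" using nz assms unfolding adm_def by auto
    then obtain x N where M: "M = add_mset (x, nx (nx v)) N" by (metis cnt_posE)
    have "adm (nx v) N"
      using assms False unfolding M adm_def by (auto split: if_splits)
    with M show ?thesis by (rule left)
  qed
qed

lemma adm_realizable: "adm v M \<Longrightarrow> \<exists>t. leaves v t = M"
proof (induction "size M" arbitrary: v M rule: less_induct)
  case less
  show ?case
  proof (cases "size M = 1")
    case True
    then obtain x c where M: "M = {#(x, c)#}" by (metis size_1_singleton_mset surj_pair)
    then have "c = v" using less.prems unfolding adm_def by (auto split: if_splits)
    then show ?thesis using M by (intro exI[of _ "Leaf x"]) simp
  next
    case False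
    from less.prems False show ?thesis
    proof (cases rule: adm_peel)
      case (right x N)
      then obtain t where "leaves (nx (nx v)) t = N" using less.hyps by fastforce
      then show ?thesis using right by (intro exI[of _ "Node t (Leaf x)"]) simp
    next
      case (left x N)
      then obtain t where "leaves (nx v) t = N" using less.hyps by fastforce
      then show ?thesis using left by (intro exI[of _ "Node (Leaf x) t"]) simp
    qed
  qed
qed

section \<open>Rearranging bracketings\<close>

text \<open>Exchanges are recorded without their signs, so this is a plain congruence;
  \<open>ev_eqv\<close> brings the sign back as a disjunction.\<close>

inductive eqv :: "'b tree \<Rightarrow> 'b tree \<Rightarrow> bool" (infix "\<simeq>" 50) where
  refl [simp, intro]: "t \<simeq> t"
| trans [trans]: "s \<simeq> t \<Longrightarrow> t \<simeq> u \<Longrightarrow> s \<simeq> u"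
| Node: "l \<simeq> l' \<Longrightarrow> r \<simeq> r' \<Longrightarrow> Node l r \<simeq> Node l' r'"
| swap_left: "Node (Node x y) z \<simeq> Node (Node z y) x"
| swap_right: "Node x (Node y z) \<simeq> Node z (Node y x)"

lemma eqv_sym: "s \<simeq> t \<Longrightarrow> t \<simeq> s"
  by (induction rule: eqv.induct) (auto intro: eqv.intros)

lemma eqv_leaves: "s \<simeq> t \<Longrightarrow> leaves v s = leaves v t"
  by (induction arbitrary: v rule: eqv.induct) auto

lemma eqv_deg: "s \<simeq> t \<Longrightarrow> deg s = deg t"
  by (metis eqv_leaves size_leaves)

text \<open>Two exchanges turn \<open>Node (Node (Node s u) q) r\<close> into
  \<open>Node u (Node s (Node r q))\<close>, whose left factor is a proper part of the old one; the
  descent stops when a leaf reaches the root.\<close>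

lemma eqv_leaf_child:
  "\<exists>t x. Node l r \<simeq> Node t (Leaf x) \<or> Node l r \<simeq> Node (Leaf x) t"
proof (induction "deg l" arbitrary: l r rule: less_induct)
  case less
  show ?case
  proof (cases l)
    case (Node p q)
    have eq: "Node l r \<simeq> Node (Node r q) p"
      unfolding Node by (rule eqv.swap_left)
    show ?thesis
    proof (cases p)
      case (Leaf x)
      then show ?thesis using eq by blast
    next
      case p: (Node s u)
      have "Node l r \<simeq> Node u (Node s (Node r q))"
        using eq unfolding p by (rule eqv.trans) (rule eqv.swap_right)
      moreover have "deg u < deg l" unfolding Node p by simp
      ultimately show ?thesis using less[of u] by (meson eqv.trans)
    qed
  qed auto
qed

section \<open>Mirror symmetry, which negates labels and interchanges left and right\<close>

fun mirror :: "'b tree \<Rightarrow> 'b tree" where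
  "mirror (Leaf x) = Leaf x"
| "mirror (Node l r) = Node (mirror r) (mirror l)"

fun neg :: "z3 \<Rightarrow> z3" where
  "neg Z0 = Z0"
| "neg Z1 = Z2"
| "neg Z2 = Z1"

lemma neg_nx [simp]: "neg (nx v) = nx (nx (neg v))"
  by (cases v) auto

lemma neg_neg [simp]: "neg (neg v) = v"
  by (cases v) auto

lemma neg_eq_iff: "neg c = d \<longleftrightarrow> c = neg d"
  by (cases c; cases d) auto

lemma mirror_mirror [simp]: "mirror (mirror t) = t"
  by (induction t) auto

lemma deg_mirror [simp]: "deg (mirror t) = deg t"
  by (induction t) auto

lemma eqv_mirror: "s \<simeq> t \<Longrightarrow> mirror s \<simeq> mirror t"
  by (induction rule: eqv.induct) (auto intro: eqv.intros)

lemma leaves_mirror: "leaves (neg v) (mirror t) = image_mset (map_prod id neg) (leaves v t)"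
proof (induction t arbitrary: v)
  case (Node l r)
  from Node.IH(1)[of "nx (nx v)"] Node.IH(2)[of "nx v"] show ?case by simp
qed simp

lemma cnt_neg: "cnt c (image_mset (map_prod id neg) M) = cnt (neg c) M"
  by (induction M) (auto simp: neg_eq_iff)

lemma adm_neg: "adm v M \<Longrightarrow> adm (neg v) (image_mset (map_prod id neg) M)"
  unfolding adm_def by (auto simp: cnt_neg)

section \<open>Bringing a prescribed leaf to the root, assuming uniqueness in smaller degree\<close>

context
  fixes n :: nat
  assumes smaller: "\<And>v (s :: 'b tree) t. deg s < n \<Longrightarrow> leaves v s = leaves v t \<Longrightarrow> s \<simeq> t"
begin

text \<open>The leaves of label \<open>v\<close> in \<open>w\<close> come in pairs, because
  \<open>a\<close> alone already realizes the root label of \<open>w\<close>. Pairs are moved into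
  the left factor until only \<open>Leaf a\<close> remains.\<close>

lemma eqv_right_leaf_if_root:
  fixes w :: "'b tree"
  assumes "leaves (nx v) w = add_mset (a, nx v) M" "\<forall>p\<in>#M. snd p = v" "deg w < n"
  shows "\<exists>z'. Node z w \<simeq> Node z' (Leaf a)"
  using assms
proof (induction "size M" arbitrary: w M z rule: less_induct)
  case less
  show ?case
  proof (cases "M = {#}")
    case True
    then show ?thesis using less.prems(1) leaves_eq_single by fastforce
  next
    case False
    then obtain c M1 where M1: "M = add_mset (c, v) M1"
      using less.prems(2) by (metis multiset_cases prod.collapse union_single_eq_member)
    have adm: "adm (nx v) (add_mset (a, nx v) M)"
      using adm_leaves[of "nx v" w] less.prems(1) by simp
    have zero: "cnt u M = 0" if "u \<noteq> v" for u
      using less.prems(2) that cnt_pos_iff[of u M] by fastforce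
    have "M1 \<noteq> {#}"
      using adm unfolding M1 adm_def by auto
    then obtain d M2 where M2: "M1 = add_mset (d, v) M2"
      using less.prems(2) M1
      by (metis multiset_cases prod.collapse union_single_eq_member insert_iff set_mset_add_mset_insert)
    have "adm (nx v) (add_mset (a, nx v) M2)"
      using adm zero unfolding M1 M2 adm_def by auto
    then obtain w2 where w2: "leaves (nx v) w2 = add_mset (a, nx v) M2"
      using adm_realizable by blast
    \<comment> \<open>By \<open>smaller\<close>, \<open>w\<close> may be taken in this shape; two
      exchanges then make \<open>w2\<close>, which still contains \<open>a\<close>, the right
      child.\<close>
    let ?w = "Node (Leaf c) (Node w2 (Leaf d))"
    have "w \<simeq> ?w"
      using w2 less.prems by (intro smaller[of _ "nx v"]) (simp_all add: M1 M2)
    then have "Node z w \<simeq> Node z ?w" by (intro eqv.Node) auto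
    also have "\<dots> \<simeq> Node (Node w2 (Leaf d)) (Node (Leaf c) z)" by (rule eqv.swap_right)
    also have "\<dots> \<simeq> Node (Node (Node (Leaf c) z) (Leaf d)) w2" by (rule eqv.swap_left)
    finally have eq: "Node z w \<simeq> Node (Node (Node (Leaf c) z) (Leaf d)) w2" .
    have "deg w2 < n"
      using arg_cong[OF w2, of size] arg_cong[OF less.prems(1), of size] less.prems(3)
      by (simp add: M1 M2)
    moreover have "size M2 < size M" "\<forall>p\<in>#M2. snd p = v"
      using less.prems(2) by (auto simp: M1 M2)
    ultimately obtain z' where "Node (Node (Node (Leaf c) z) (Leaf d)) w2 \<simeq> Node z' (Leaf a)"
      using less.hyps w2 by blast
    then show ?thesis using eqv.trans[OF eq] by blast
  qed
qed

text \<open>If \<open>a\<close> can be made the left child of \<open>y\<close>, one exchange carries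
  it to the right of the root. Otherwise \<open>M\<close> fails only the degenerate clause, so it is
  labelled \<open>v\<close> throughout, and \<open>eqv_right_leaf_if_root\<close> applies after an
  exchange.\<close>

lemma eqv_right_leaf_if_left:
  fixes y :: "'b tree"
  assumes "leaves (nx (nx v)) y = add_mset (a, nx v) M" "deg y < n"
  shows "\<exists>z. Node y x \<simeq> Node z (Leaf a)"
proof -
  have ady: "adm (nx (nx v)) (add_mset (a, nx v) M)"
    using adm_leaves[of "nx (nx v)" y] assms(1) by simp
  show ?thesis
  proof (cases "adm v M")
    case True
    then obtain u where "leaves v u = M" using adm_realizable by blast
    then have "y \<simeq> Node (Leaf a) u"
      using assms by (intro smaller[of _ "nx (nx v)"]) auto
    then have "Node y x \<simeq> Node (Node (Leaf a) u) x" by (intro eqv.Node) auto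
    also have "\<dots> \<simeq> Node (Node x u) (Leaf a)" by (rule eqv.swap_left)
    finally show ?thesis by blast
  next
    case False
    have c: "cnt (nx v) M = 0" "cnt (nx (nx v)) M = 0" "odd (cnt v M)"
      using ady False unfolding adm_def by auto
    obtain d M1 where M1: "M = add_mset (d, v) M1"
      using c(3) cnt_posE[of v M] by (metis odd_pos)
    have "adm (nx v) (add_mset (a, nx v) M1)"
      using ady c unfolding M1 adm_def by (auto split: if_splits)
    then obtain w where w: "leaves (nx v) w = add_mset (a, nx v) M1"
      using adm_realizable by blast
    have "y \<simeq> Node w (Leaf d)"
      using assms w by (intro smaller[of _ "nx (nx v)"]) (auto simp: M1)
    then have "Node y x \<simeq> Node (Node w (Leaf d)) x" by (intro eqv.Node) auto
    also have "\<dots> \<simeq> Node (Node x (Leaf d)) w" by (rule eqv.swap_left)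
    finally have eq: "Node y x \<simeq> Node (Node x (Leaf d)) w" .
    have "\<forall>p\<in>#M1. snd p = v"
    proof
      fix p assume "p \<in># M1"
      then have "0 < cnt (snd p) M" by (metis M1 cnt_pos_iff insert_iff prod.collapse set_mset_add_mset_insert)
      then show "snd p = v" using c by (cases rule: z3_cases[of "snd p" v]) auto
    qed
    moreover have "deg w < n"
      using arg_cong[OF w, of size] arg_cong[OF assms(1), of size] assms(2) by (simp add: M1)
    ultimately show ?thesis
      using eqv_right_leaf_if_root[OF w] eq by (meson eqv.trans)
  qed
qed

text \<open>Some leaf \<open>b\<close> can be made a child of the root. If it is the right child,
  \<open>a\<close> is \<open>b\<close> or lies in the left factor. If it is the left child, the
  right factor is rearranged until exchanges bring \<open>a\<close> over.\<close>

lemma eqv_right_leaf: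
  fixes t :: "'b tree"
  assumes t: "leaves v t = add_mset (a, nx v) M" "adm (nx (nx v)) M" and "deg t = n"
  shows "\<exists>z. t \<simeq> Node z (Leaf a)"
proof -
  obtain l r where "t = Node l r"
    using assms by (cases t) (auto simp: adm_def)
  then obtain t' b where tb: "t \<simeq> Node t' (Leaf b) \<or> t \<simeq> Node (Leaf b) t'"
    using eqv_leaf_child by metis
  then have dt': "deg t' < n" using eqv_deg assms(3) by fastforce
  from tb show ?thesis
  proof
    assume eq: "t \<simeq> Node t' (Leaf b)"
    then have l: "add_mset (a, nx v) M = add_mset (b, nx v) (leaves (nx (nx v)) t')"
      using eqv_leaves[OF eq, of v] t(1) by simp
    show ?thesis
    proof (cases "b = a")
      case True
      then show ?thesis using eq by blast
    next
      case False
      then have "(a, nx v) \<in># leaves (nx (nx v)) t'" using l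
        by (metis Pair_inject insert_iff set_mset_add_mset_insert union_single_eq_member)
      then obtain N where "leaves (nx (nx v)) t' = add_mset (a, nx v) N" by (metis insert_DiffM)
      then show ?thesis using eqv_right_leaf_if_left dt' eq by (meson eqv.trans)
    qed
  next
    assume eq: "t \<simeq> Node (Leaf b) t'"
    then have l: "add_mset (a, nx v) M = add_mset (b, nx (nx v)) (leaves (nx v) t')"
      using eqv_leaves[OF eq, of v] t(1) by simp
    have "(a, nx v) \<in># leaves (nx v) t'" using l
      by (metis Pair_inject insert_iff nx_neq(2) set_mset_add_mset_insert union_single_eq_member)
    then obtain N where N: "leaves (nx v) t' = add_mset (a, nx v) N" by (metis insert_DiffM)
    have M: "M = add_mset (b, nx (nx v)) N" using l N by simp
    have adt': "adm (nx v) (add_mset (a, nx v) N)"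
      using adm_leaves[of "nx v" t'] N by simp
    show ?thesis
    \<comment> \<open>A leaf \<open>d\<close> of label \<open>v\<close> can be split off on the left
      of \<open>t'\<close>; the exchange with \<open>b\<close> then moves the part containing
      \<open>a\<close> into the left factor.\<close>
    proof (cases "0 < cnt v N")
      case True
      then obtain d N1 where N1: "N = add_mset (d, v) N1" by (rule cnt_posE)
      have "adm (nx (nx v)) (add_mset (a, nx v) N1)"
        using adt' unfolding N1 adm_def by auto
      then obtain y where y: "leaves (nx (nx v)) y = add_mset (a, nx v) N1"
        using adm_realizable by blast
      have "t' \<simeq> Node (Leaf d) y"
        using y dt' by (intro smaller[of _ "nx v"]) (auto simp: N N1)
      then have "Node (Leaf b) t' \<simeq> Node (Leaf b) (Node (Leaf d) y)" by (intro eqv.Node) auto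
      also have "\<dots> \<simeq> Node y (Node (Leaf d) (Leaf b))" by (rule eqv.swap_right)
      finally have "t \<simeq> Node y (Node (Leaf d) (Leaf b))" using eq by (meson eqv.trans)
      moreover have "deg y < n"
        using arg_cong[OF y, of size] arg_cong[OF N, of size] dt' by (simp add: N1)
      ultimately show ?thesis
        using eqv_right_leaf_if_left[OF y] by (meson eqv.trans)
    next
      case False
      show ?thesis
      \<comment> \<open>With no label \<open>v\<close> in \<open>N\<close>, either \<open>t'\<close>
        is \<open>Leaf a\<close>, by admissibility of \<open>M\<close>, or parity supplies both a
        second leaf of label \<open>nx v\<close> and one of label \<open>nx (nx v)\<close>.\<close>
      proof (cases "cnt (nx v) N = 0")
        case True
        then have "cnt (nx (nx v)) N = 0"
          using False t(2) unfolding M adm_def by auto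
        then have "N = {#}" using True False size_eq_cnt[of N v] by simp
        then have "t' = Leaf a" using N leaves_eq_single by fastforce
        then show ?thesis using eq by blast
      next
        case nz: False
        then obtain a' N1 where N1: "N = add_mset (a', nx v) N1" by (metis cnt_posE gr0I)
        have "0 < cnt (nx (nx v)) N1"
          using False adt' unfolding N1 adm_def by auto
        then obtain d N2 where N2: "N1 = add_mset (d, nx (nx v)) N2" by (rule cnt_posE)
        have "adm v N2"
          using False adt' unfolding N1 N2 adm_def by auto
        then obtain u where u: "leaves v u = N2" using adm_realizable by blast
        have "t' \<simeq> Node (Node (Leaf d) (Leaf a')) (Node (Leaf a) u)"
          using u dt' by (intro smaller[of _ "nx v"]) (auto simp: N N1 N2)
        then have "Node (Leaf b) t' \<simeq> Node (Leaf b) (Node (Node (Leaf d) (Leaf a')) (Node (Leaf a) u))"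
          by (intro eqv.Node) auto
        also have "\<dots> \<simeq> Node (Node (Leaf a) u) (Node (Node (Leaf d) (Leaf a')) (Leaf b))"
          by (rule eqv.swap_right)
        also have "\<dots> \<simeq> Node (Node (Node (Node (Leaf d) (Leaf a')) (Leaf b)) u) (Leaf a)"
          by (rule eqv.swap_left)
        finally show ?thesis using eq by (meson eqv.trans)
      qed
    qed
  qed
qed

lemma eqv_left_leaf:
  fixes t :: "'b tree"
  assumes "leaves v t = add_mset (a, nx (nx v)) M" "adm (nx v) M" "deg t = n"
  shows "\<exists>z. t \<simeq> Node (Leaf a) z"
proof -
  have "leaves (neg v) (mirror t) = add_mset (a, nx (neg v)) (image_mset (map_prod id neg) M)"
    using assms(1) by (simp add: leaves_mirror)
  moreover have "adm (nx (nx (neg v))) (image_mset (map_prod id neg) M)"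
    using adm_neg[OF assms(2)] by simp
  ultimately obtain z where "mirror t \<simeq> Node z (Leaf a)"
    using eqv_right_leaf assms(3) by (metis deg_mirror)
  then have "t \<simeq> Node (Leaf a) (mirror z)"
    using eqv_mirror by fastforce
  then show ?thesis by blast
qed

end

text \<open>\<open>adm_peel\<close> names a leaf that may stand at the root; both bracketings are
  rearranged to have it there, and induction applies to the remaining factors.\<close>

theorem leaves_eq_imp_eqv: "leaves v s = leaves v t \<Longrightarrow> s \<simeq> t"
proof (induction "deg s" arbitrary: v s t rule: less_induct)
  case less
  have dt: "deg t = deg s" by (metis less.prems size_leaves)
  show ?case
  proof (cases "deg s = 1")
    case True
    then obtain p where "leaves v s = {#p#}" by (metis size_leaves size_1_singleton_mset)
    then show ?thesis using leaves_eq_single less.prems by (metis eqv.refl)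
  next
    case False
    from adm_leaves[of v s] False show ?thesis
      unfolding size_leaves[of v s, symmetric]
    proof (cases rule: adm_peel)
      case (right x N)
      have "\<exists>z. u \<simeq> Node z (Leaf x)" if "leaves v u = leaves v s" "deg u = deg s" for u
        by (rule eqv_right_leaf[of "deg s"]) (use less.hyps right that in auto)
      then obtain y z where y: "s \<simeq> Node y (Leaf x)" and z: "t \<simeq> Node z (Leaf x)"
        using less.prems dt by metis
      have "y \<simeq> z"
        using eqv_leaves[OF y, of v] eqv_leaves[OF z, of v] less.prems eqv_deg[OF y]
        by (intro less.hyps[of _ "nx (nx v)"]) auto
      then have "s \<simeq> Node z (Leaf x)" using y by (meson eqv.trans eqv.Node eqv.refl)
      then show ?thesis using z by (meson eqv.trans eqv_sym)
    next
      case (left x N)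
      have "\<exists>z. u \<simeq> Node (Leaf x) z" if "leaves v u = leaves v s" "deg u = deg s" for u
        by (rule eqv_left_leaf[of "deg s"]) (use less.hyps left that in auto)
      then obtain y z where y: "s \<simeq> Node (Leaf x) y" and z: "t \<simeq> Node (Leaf x) z"
        using less.prems dt by metis
      have "y \<simeq> z"
        using eqv_leaves[OF y, of v] eqv_leaves[OF z, of v] less.prems eqv_deg[OF y]
        by (intro less.hyps[of _ "nx v"]) auto
      then have "s \<simeq> Node (Leaf x) z" using y by (meson eqv.trans eqv.Node eqv.refl)
      then show ?thesis using z by (meson eqv.trans eqv_sym)
    qed
  qed
qed

text \<open>Bracketings whose value drops degree in a descendingly flexible algebra.\<close>

inductive nil :: "'b tree \<Rightarrow> bool" where
  nil_left: "nil (Node (Node x y) x)"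
| nil_right: "nil (Node x (Node y x))"
| nil_Node1: "nil l \<Longrightarrow> nil (Node l r)"
| nil_Node2: "nil r \<Longrightarrow> nil (Node l r)"

text \<open>Wrapping two equal leaves around \<open>u\<close> by opposite turns keeps the root label
  of \<open>u\<close>; the order of the turns selects the label \<open>nx v\<close> or
  \<open>nx (nx v)\<close>.\<close>

lemma nil_insert:
  assumes "c \<noteq> v"
  shows "\<exists>t. nil t \<and> leaves v t = leaves v u + {#(a, c), (a, c)#}"
proof (cases rule: z3_cases[of c v])
  case 2
  then show ?thesis
    by (intro exI[of _ "Node (Node (Leaf a) u) (Leaf a)"]) (simp add: nil_left)
next
  case 3
  then show ?thesis
    by (intro exI[of _ "Node (Leaf a) (Node u (Leaf a))"]) (simp add: nil_right)
qed (use assms in simp)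

text \<open>The second alternative for the remaining leaves cannot be dropped:
  for leaves \<open>a\<close>, \<open>a\<close> labelled \<open>nx v\<close> and at least three leaves labelled \<open>v\<close>
  the value need not drop degree.\<close>

lemma eqv_nil_if_duplicate:
  assumes "leaves v t = M + {#(a, c), (a, c)#}"
    and "c = v \<or> (\<exists>p\<in>#M. snd p \<noteq> v)"
  shows "\<exists>t'. t \<simeq> t' \<and> nil t'"
proof -
  have ad: "adm v (M + {#(a, c), (a, c)#})" using adm_leaves[of v t] assms(1) by simp
  have "0 < cnt (nx v) M \<or> 0 < cnt (nx (nx v)) M"
  proof (cases "\<exists>p\<in>#M. snd p \<noteq> v")
    case True
    then obtain p where p: "p \<in># M" "snd p \<noteq> v" by blast
    then have "0 < cnt (snd p) M" unfolding cnt_pos_iff by (metis prod.collapse)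
    then show ?thesis using p by (cases rule: z3_cases[of "snd p" v]) auto
  next
    case False
    then have "c = v" using assms(2) by blast
    then show ?thesis using ad unfolding adm_def by auto
  qed
  then have "adm v M"
    using ad unfolding adm_def by (auto split: if_splits)
  then obtain u where u: "leaves v u = M" using adm_realizable by blast
  have "\<exists>t'. nil t' \<and> leaves v t' = leaves v u + {#(a, c), (a, c)#}"
  proof (cases "c = v")
    case True
    \<comment> \<open>A pair with the root label does not fit around the root, so it is wrapped
      around the left factor of \<open>u\<close>. That factor exists, since three leaves of label
      \<open>v\<close> alone are not admissible.\<close>
    obtain l r where lr: "u = Node l r"
    proof (cases u)
      case (Leaf x)
      then have "M = {#(x, v)#}" using u by simp
      then show ?thesis using ad True by (simp add: adm_def)
    qed
    obtain l' where "nil l'" "leaves (nx (nx v)) l' = leaves (nx (nx v)) l + {#(a, c), (a, c)#}"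
      using nil_insert[of c "nx (nx v)" l a] True by auto
    then show ?thesis
      unfolding lr by (intro exI[of _ "Node l' r"]) (simp add: nil_Node1)
  next
    case False
    then show ?thesis by (rule nil_insert)
  qed
  then show ?thesis using leaves_eq_imp_eqv assms(1) u by metis
qed

section \<open>Evaluating bracketings\<close>

fun subst :: "'b \<Rightarrow> 'b tree \<Rightarrow> 'b tree \<Rightarrow> 'b tree" where
  "subst h e (Leaf x) = (if x = h then e else Leaf x)"
| "subst h e (Node l r) = Node (subst h e l) (subst h e r)"

lemma leaves_subst_all:
  "leaves v (subst h e t) =
     filter_mset (\<lambda>p. fst p \<noteq> h) (leaves v t) +
     (\<Sum>p\<in>#filter_mset (\<lambda>p. fst p = h) (leaves v t). leaves (snd p) e)"
  by (induction t arbitrary: v) auto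

lemma leaves_subst:
  assumes "leaves v t = add_mset (h, c) M" "\<forall>p\<in>#M. fst p \<noteq> h"
  shows "leaves v (subst h e t) = leaves c e + M"
proof -
  have "filter_mset (\<lambda>p. fst p \<noteq> h) M = M"
    using assms(2) by (simp add: filter_mset_eq_conv)
  moreover have "filter_mset (\<lambda>p. fst p = h) M = {#}"
    using assms(2) by simp
  ultimately show ?thesis unfolding leaves_subst_all assms(1) by (auto simp del: filter_mset_eq_mempty_iff)
qed

definition tag :: "('b \<Rightarrow> z3) \<Rightarrow> 'b set \<Rightarrow> ('b \<times> z3) multiset" where
  "tag g I = image_mset (\<lambda>i. (i, g i)) (mset_set I)"

lemma tag_simps [simp]:
  "tag g {} = {#}"
  "finite I \<Longrightarrow> x \<notin> I \<Longrightarrow> tag g (insert x I) = add_mset (x, g x) (tag g I)"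
  by (auto simp: tag_def)

lemma tag_remove: "finite I \<Longrightarrow> x \<in> I \<Longrightarrow> tag g I = add_mset (x, g x) (tag g (I - {x}))"
  by (metis Diff_iff finite_Diff insert_Diff insertCI tag_simps(2))

lemma tag_Un_disjoint:
  "finite I \<Longrightarrow> finite J \<Longrightarrow> I \<inter> J = {} \<Longrightarrow> tag g (I \<union> J) = tag g I + tag g J"
  by (simp add: tag_def mset_set_Union)

lemma size_tag: "finite I \<Longrightarrow> size (tag g I) = card I"
  by (simp add: tag_def)

lemma set_tag: "finite I \<Longrightarrow> set_mset (tag g I) = (\<lambda>i. (i, g i)) ` I"
  by (simp add: tag_def)

lemma cnt_tag: "finite I \<Longrightarrow> cnt c (tag g I) = card {i \<in> I. g i = c}"
proof (induction I rule: finite_induct)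
  case (insert x I)
  have "{i \<in> insert x I. g i = c} = (if g x = c then insert x {i \<in> I. g i = c} else {i \<in> I. g i = c})"
    by auto
  then show ?case using insert by simp
qed simp

context nonassoc_algebra
begin

fun ev :: "('b \<Rightarrow> 'a) \<Rightarrow> 'b tree \<Rightarrow> 'a" where
  "ev y (Leaf x) = y x"
| "ev y (Node l r) = ev y l \<cdot> ev y r"

lemma ev_subst: "ev y (subst h e t) = ev (y(h := ev y e)) t"
  by (induction t) auto

lemma mult_zero [simp]: "0 \<cdot> a = 0" "a \<cdot> 0 = 0"
  using mult_add_left[of 0 0 a] mult_add_right[of a 0 0] by auto

lemma mult_minus: "(- a) \<cdot> b = - (a \<cdot> b)" "a \<cdot> (- b) = - (a \<cdot> b)"
  using mult_add_left[of a "- a" b] mult_add_right[of a b "- b"]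
  by (simp_all add: eq_neg_iff_add_eq_0 add.commute)

lemma mult_diff: "(a - b) \<cdot> c = a \<cdot> c - b \<cdot> c" "c \<cdot> (a - b) = c \<cdot> a - c \<cdot> b"
  using mult_add_left[of a "- b" c] mult_add_right[of c a "- b"] by (simp_all add: mult_minus)

lemma subspace_\<L>: "subspace (\<L> k S)"
  unfolding \<L>_def by (rule subspace_span)

lemma \<L>_in_mono: "x \<in> \<L> i S \<Longrightarrow> i \<le> j \<Longrightarrow> x \<in> \<L> j S"
  using \<L>_mono by blast

lemma unity_in_\<L>: "e \<in> unity \<Longrightarrow> e \<in> \<L> k S"
  using word_in_\<L>[OF word_unity] by blast

lemma ev_in_\<L>: "(\<And>x. y x \<in> \<L> 1 S) \<Longrightarrow> ev y t \<in> \<L> (deg t) S"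
  by (induction t) (auto intro: \<L>_mult)

section \<open>Bracketings with one hole as linear maps\<close>

definition linear_map :: "('a \<Rightarrow> 'a) \<Rightarrow> bool" where
  "linear_map f \<longleftrightarrow> (\<forall>x y. f (x + y) = f x + f y) \<and> (\<forall>r x. f (r *s x) = r *s f x)"

lemma linear_mapD:
  assumes "linear_map f"
  shows "f (x + y) = f x + f y" "f (r *s x) = r *s f x" "f 0 = 0"
proof -
  show "f (x + y) = f x + f y" "f (r *s x) = r *s f x" for x
    using assms unfolding linear_map_def by auto
  from this(2)[of 0] show "f 0 = 0"
    using assms unfolding linear_map_def by (metis scale_zero_left)
qed

lemma linear_map_mult [simp]: "linear_map (\<lambda>x. x \<cdot> a)" "linear_map (\<lambda>x. a \<cdot> x)"
  unfolding linear_map_def by (simp_all add: mult_add_left mult_add_right mult_scale_left mult_scale_right)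

lemma linear_map_span:
  assumes "linear_map f" "subspace N" "f ` X \<subseteq> N" "x \<in> span X"
  shows "f x \<in> N"
  using assms(4)
proof (induction rule: span_induct_alt)
  case base
  then show ?case using linear_mapD(3)[OF assms(1)] assms(2) subspace_0 by simp
next
  case (step c x y)
  then have "c *s f x + f y \<in> N"
    using assms(2,3) by (intro subspace_add subspace_scale) auto
  then show ?case by (simp add: linear_mapD[OF assms(1)])
qed

fun occ :: "'b \<Rightarrow> 'b tree \<Rightarrow> nat" where
  "occ h (Leaf x) = (if x = h then 1 else 0)"
| "occ h (Node l r) = occ h l + occ h r"

lemma occ_leaves: "occ h t = size (filter_mset (\<lambda>p. fst p = h) (leaves v t))"
  by (induction t arbitrary: v) auto

lemma ev_upd_not_occ: "occ h t = 0 \<Longrightarrow> ev (y(h := x)) t = ev y t"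
  by (induction t) auto

lemma linear_map_ev:
  assumes "occ h t = 1"
  shows "linear_map (\<lambda>x. ev (y(h := x)) t)"
  using assms
proof (induction t)
  case (Node l r)
  then consider "occ h l = 1" "occ h r = 0" | "occ h l = 0" "occ h r = 1"
    by (auto simp: add_is_1)
  then show ?case
    using Node.IH unfolding linear_map_def
    by cases (auto simp: ev_upd_not_occ mult_add_left mult_add_right mult_scale_left mult_scale_right)
qed (simp add: linear_map_def split: if_splits)

lemma ev_upd_in_\<L>:
  assumes "occ h t = 1" "\<And>i. y i \<in> \<L> 1 S" "x \<in> \<L> k S"
  shows "ev (y(h := x)) t \<in> \<L> (k + deg t - 1) S"
  using assms(1)
proof (induction t)
  case (Leaf i)
  then show ?case using assms(3) by (simp split: if_splits)
next
  case (Node l r)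
  then consider "occ h l = 1" "occ h r = 0" | "occ h l = 0" "occ h r = 1"
    by (auto simp: add_is_1)
  then show ?case
  proof cases
    case 1
    have "ev (y(h := x)) l \<cdot> ev y r \<in> \<L> ((k + deg l - 1) + deg r) S"
      by (rule \<L>_mult[OF Node.IH(1)[OF 1(1)] ev_in_\<L>]) (rule assms(2))
    then show ?thesis using 1 deg_pos[of l] by (simp add: ev_upd_not_occ add.assoc del: fun_upd_apply)
  next
    case 2
    have "ev y l \<cdot> ev (y(h := x)) r \<in> \<L> (deg l + (k + deg r - 1)) S"
      by (rule \<L>_mult[OF ev_in_\<L> Node.IH(2)[OF 2(2)]]) (rule assms(2))
    moreover have "deg l + (k + deg r - 1) = k + (deg l + deg r) - 1"
      using deg_pos[of r] by linarith
    ultimately show ?thesis using 2 by (simp add: ev_upd_not_occ del: fun_upd_apply)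
  qed
qed

section \<open>Descending flexibility modulo lower degree\<close>

lemma \<L>2'_subset:
  assumes "x \<in> \<L> i S" "y \<in> \<L> j S" "z \<in> \<L> k S" "1 \<le> i" "1 \<le> j" "1 \<le> k"
  shows "\<L>2' x y z \<subseteq> \<L> (i + j + k - 1) S"
proof -
  \<comment> \<open>Each spanning product omits at least one of the three factors, and that factor
    counts for degree at least 1.\<close>
  have "u \<cdot> w \<in> \<L> (i + j + k - 1) S"
    if "u \<in> \<L> a S" "w \<in> \<L> b S" "a + b \<le> i + j + k - 1" for u w a b
    using \<L>_mult[OF that(1,2)] that(3) \<L>_in_mono by blast
  then show ?thesis
    unfolding \<L>2'_def using assms
    by (intro span_minimal subspace_\<L>)
      (auto intro: unity_in_\<L> \<L>_in_mono simp: add.commute)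
qed

lemma flexible_swap:
  assumes "descendingly_flexible"
    and "x \<in> \<L> i S" "y \<in> \<L> j S" "z \<in> \<L> k S" "1 \<le> i" "1 \<le> j" "1 \<le> k"
  shows "(x \<cdot> y) \<cdot> z + (z \<cdot> y) \<cdot> x \<in> \<L> (i + j + k - 1) S"
    and "x \<cdot> (y \<cdot> z) + z \<cdot> (y \<cdot> x) \<in> \<L> (i + j + k - 1) S"
  using assms(1) \<L>2'_subset[OF assms(2-)] unfolding descendingly_flexible_def by blast+

lemma flexible_nil:
  assumes "descendingly_flexible" "x \<in> \<L> i S" "y \<in> \<L> j S" "1 \<le> i" "1 \<le> j"
  shows "(x \<cdot> y) \<cdot> x \<in> \<L> (2 * i + j - 1) S" "x \<cdot> (y \<cdot> x) \<in> \<L> (2 * i + j - 1) S"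
proof -
  have "u \<cdot> w \<in> \<L> (2 * i + j - 1) S"
    if "u \<in> \<L> a S" "w \<in> \<L> b S" "a + b \<le> 2 * i + j - 1" for u w a b
    using \<L>_mult[OF that(1,2)] that(3) \<L>_in_mono by blast
  then have "\<L> 1 {x, y, x \<cdot> x, x \<cdot> y, y \<cdot> x} \<subseteq> \<L> (2 * i + j - 1) S"
    unfolding \<L>_1 using assms
    by (intro span_minimal subspace_\<L>) (auto intro: unity_in_\<L> \<L>_in_mono)
  then show "(x \<cdot> y) \<cdot> x \<in> \<L> (2 * i + j - 1) S" "x \<cdot> (y \<cdot> x) \<in> \<L> (2 * i + j - 1) S"
    using assms(1) unfolding descendingly_flexible_def by blast+
qed

text \<open>Each exchange negates the value modulo lower degree. The number of exchanges is not
  tracked: for deciding whether a value drops degree, either sign is good enough.\<close>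

lemma ev_eqv:
  assumes "descendingly_flexible" "s \<simeq> t" "\<And>x. y x \<in> \<L> 1 S"
  shows "ev y s - ev y t \<in> \<L> (deg s - 1) S \<or> ev y s + ev y t \<in> \<L> (deg s - 1) S"
  using assms(2)
proof (induction rule: eqv.induct)
  case (refl t)
  then show ?case by (simp add: subspace_0 subspace_\<L>)
next
  case (trans s t u)
  have *: "a \<in> \<L> k S \<Longrightarrow> b \<in> \<L> k S \<Longrightarrow> a + b \<in> \<L> k S \<and> a - b \<in> \<L> k S" for a b k
    using subspace_\<L> subspace_add subspace_diff by blast
  have eqs: "ev y s - ev y u = (ev y s - ev y t) + (ev y t - ev y u)"
    "ev y s - ev y u = (ev y s + ev y t) - (ev y t + ev y u)"
    "ev y s + ev y u = (ev y s - ev y t) + (ev y t + ev y u)"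
    "ev y s + ev y u = (ev y s + ev y t) - (ev y t - ev y u)"
    by simp_all
  from trans.IH show ?case
    unfolding eqv_deg[OF trans.hyps(1), symmetric]
    by (elim disjE) (use * eqs in metis)+
next
  case (Node l l' r r')
  have dl: "deg l' = deg l" "deg r' = deg r" using Node.hyps eqv_deg by metis+
  have 1: "d \<cdot> ev y r \<in> \<L> (deg l + deg r - 1) S" if "d \<in> \<L> (deg l - 1) S" for d
    using \<L>_mult[OF that ev_in_\<L>[of y S r, OF assms(3)]] deg_pos[of l] by simp
  have 2: "ev y l' \<cdot> d \<in> \<L> (deg l + deg r - 1) S" if "d \<in> \<L> (deg r - 1) S" for d
    using \<L>_mult[OF ev_in_\<L>[of y S l', OF assms(3)] that] deg_pos[of r] dl by simp
  have *: "a \<in> \<L> k S \<Longrightarrow> b \<in> \<L> k S \<Longrightarrow> a + b \<in> \<L> k S \<and> a - b \<in> \<L> k S" for a b k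
    using subspace_\<L> subspace_add subspace_diff by blast
  \<comment> \<open>One telescoping identity for each combination of signs in the two factors; both
    terms on the right contain a factor of lower degree.\<close>
  have eqs: "ev y l \<cdot> ev y r - ev y l' \<cdot> ev y r'
      = (ev y l - ev y l') \<cdot> ev y r + ev y l' \<cdot> (ev y r - ev y r')"
    "ev y l \<cdot> ev y r + ev y l' \<cdot> ev y r'
      = (ev y l - ev y l') \<cdot> ev y r + ev y l' \<cdot> (ev y r + ev y r')"
    "ev y l \<cdot> ev y r - ev y l' \<cdot> ev y r'
      = (ev y l + ev y l') \<cdot> ev y r - ev y l' \<cdot> (ev y r + ev y r')"
    "ev y l \<cdot> ev y r + ev y l' \<cdot> ev y r'
      = (ev y l + ev y l') \<cdot> ev y r - ev y l' \<cdot> (ev y r - ev y r')"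
    by (simp_all add: mult_diff mult_add_left mult_add_right)
  from Node.IH show ?case
    unfolding ev.simps deg.simps
    by (elim disjE) (use 1 2 * eqs in metis)+
next
  case (swap_left a b c)
  have "(ev y a \<cdot> ev y b) \<cdot> ev y c + (ev y c \<cdot> ev y b) \<cdot> ev y a
      \<in> \<L> (deg a + deg b + deg c - 1) S"
    by (rule flexible_swap[OF assms(1)]) (auto intro: ev_in_\<L> assms(3) simp: Suc_leI)
  then show ?case by simp
next
  case (swap_right a b c)
  have "ev y a \<cdot> (ev y b \<cdot> ev y c) + ev y c \<cdot> (ev y b \<cdot> ev y a)
      \<in> \<L> (deg a + deg b + deg c - 1) S"
    by (rule flexible_swap[OF assms(1)]) (auto intro: ev_in_\<L> assms(3) simp: Suc_leI)
  then show ?case by (simp add: add.assoc)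
qed

lemma ev_eqv_lower:
  assumes "descendingly_flexible" "s \<simeq> t" "\<And>x. y x \<in> \<L> 1 S" "ev y t \<in> \<L> (deg t - 1) S"
  shows "ev y s \<in> \<L> (deg s - 1) S"
  using ev_eqv[OF assms(1,2), of y S, OF assms(3)]
proof
  have t: "ev y t \<in> \<L> (deg s - 1) S"
    using assms(4) eqv_deg[OF assms(2)] by simp
  {
    assume "ev y s - ev y t \<in> \<L> (deg s - 1) S"
    from subspace_add[OF subspace_\<L> this t] show ?thesis by simp
  next
    assume "ev y s + ev y t \<in> \<L> (deg s - 1) S"
    from subspace_diff[OF subspace_\<L> this t] show ?thesis by simp
  }
qed

lemma ev_nil:
  assumes "descendingly_flexible" "nil t" "\<And>x. y x \<in> \<L> 1 S"
  shows "ev y t \<in> \<L> (deg t - 1) S"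
  using assms(2)
proof (induction rule: nil.induct)
  case (nil_left a b)
  have "(ev y a \<cdot> ev y b) \<cdot> ev y a \<in> \<L> (2 * deg a + deg b - 1) S"
    by (rule flexible_nil[OF assms(1)]) (auto intro: ev_in_\<L> assms(3) simp: Suc_leI)
  moreover have "2 * deg a + deg b - 1 = deg (Node (Node a b) a) - 1" by simp
  ultimately show ?case by (simp only: ev.simps)
next
  case (nil_right a b)
  have "ev y a \<cdot> (ev y b \<cdot> ev y a) \<in> \<L> (2 * deg a + deg b - 1) S"
    by (rule flexible_nil[OF assms(1)]) (auto intro: ev_in_\<L> assms(3) simp: Suc_leI)
  moreover have "2 * deg a + deg b - 1 = deg (Node a (Node b a)) - 1" by simp
  ultimately show ?case by (simp only: ev.simps)
next
  case (nil_Node1 l r)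
  from \<L>_mult[OF nil_Node1.IH ev_in_\<L>[of y S r, OF assms(3)]] show ?case
    using deg_pos[of l] by simp
next
  case (nil_Node2 r l)
  from \<L>_mult[OF ev_in_\<L>[of y S l, OF assms(3)] nil_Node2.IH] show ?case
    using deg_pos[of r] by simp
qed

lemma ev_duplicate:
  assumes "descendingly_flexible" "\<And>x. y x \<in> \<L> 1 S"
    and "leaves v t = M + {#(a, c), (a, c)#}" "c = v \<or> (\<exists>p\<in>#M. snd p \<noteq> v)"
  shows "ev y t \<in> \<L> (deg t - 1) S"
proof -
  obtain t' where "t \<simeq> t'" "nil t'" using eqv_nil_if_duplicate[OF assms(3,4)] by blast
  then show ?thesis
    using ev_eqv_lower[where y = y and S = S, OF assms(1) _ assms(2)] ev_nil[where y = y and S = S, OF assms(1) _ assms(2)] by blast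
qed

end

section \<open>Linear independence by separating maps\<close>

context fin_dim_nonassoc_algebra
begin

lemma dim_insert_functional:
  assumes "linear_map f" "subspace N" "f ` X \<subseteq> N" "f x \<notin> N"
  shows "dim (insert x X) = Suc (dim X)"
proof -
  have "x \<notin> span X" using linear_map_span assms by blast
  then show ?thesis by (simp add: dim_insert)
qed

text \<open>Modulo \<open>N\<close> the maps \<open>f i\<close> act as a dual family to the
  \<open>e i\<close> and kill \<open>X\<close>, so the \<open>e i\<close> are linearly independent
  modulo the span of \<open>X\<close>.\<close>

lemma dim_Un_functionals:
  assumes "finite F" "subspace N"
    and "\<And>i. i \<in> F \<Longrightarrow> linear_map (f i)" "\<And>i. i \<in> F \<Longrightarrow> f i ` X \<subseteq> N"
    and "\<And>i. i \<in> F \<Longrightarrow> f i (e i) \<notin> N"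
    and "\<And>i j. i \<in> F \<Longrightarrow> j \<in> F \<Longrightarrow> i \<noteq> j \<Longrightarrow> f i (e j) \<in> N"
  shows "dim (X \<union> e ` F) = dim X + card F"
  using assms
proof (induction F rule: finite_induct)
  case (insert i F)
  have "dim (insert (e i) (X \<union> e ` F)) = Suc (dim (X \<union> e ` F))"
  proof (rule dim_insert_functional[of "f i" N])
    have "f i (e j) \<in> N" if "j \<in> F" for j
      using insert.prems(5)[of i j] insert.hyps(2) that by auto
    then show "f i ` (X \<union> e ` F) \<subseteq> N" using insert.prems(3)[of i] by auto
  qed (use insert.prems in auto)
  moreover have "dim (X \<union> e ` F) = dim X + card F"
    using insert by auto
  ultimately show ?case using insert.hyps by simp
qed simp

end

section \<open>Growth of the filtration\<close>

lemma cnt_tag_Diff: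
  assumes "finite T" "I \<subseteq> T"
  shows "cnt c (tag g T) = cnt c (tag g I) + cnt c (tag g (T - I))"
proof -
  have "tag g T = tag g I + tag g (T - I)"
    using tag_Un_disjoint[of I "T - I" g] assms
    by (metis Diff_disjoint Diff_partition finite_Diff finite_subset)
  then show ?thesis by simp
qed

lemma cnt_tag_pos: "finite I \<Longrightarrow> 0 < cnt c (tag g I) \<longleftrightarrow> (\<exists>i\<in>I. g i = c)"
  by (auto simp: cnt_tag card_gt_0_iff)

text \<open>Modulo 2, the label counts of \<open>I\<close> and of a single leaf labelled
  \<open>v\<close> differ by a multiple of (1,1,1), which does not affect the parity conditions at
  \<open>r\<close>; so a hole can replace \<open>I\<close>. The last hypothesis excludes the
  degenerate clause.\<close>

lemma adm_context:
  assumes "finite T" "I \<subseteq> T" "adm r (tag g T)" "adm v (tag g I)"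
    and "v \<noteq> r \<or> I = T \<or> (\<exists>p\<in>T - I. g p \<noteq> r)"
  shows "adm r (add_mset (h, v) (tag g (T - I)))"
proof -
  note cnts = cnt_tag_Diff[OF assms(1,2), where g = g]
  have "0 < cnt (nx r) (tag g (T - I)) \<or> 0 < cnt (nx (nx r)) (tag g (T - I))"
    if "p \<in> T - I" "g p \<noteq> r" for p
    using that assms(1) by (cases rule: z3_cases[of "g p" r]) (auto simp: cnt_tag_pos)
  then have nz: "v \<noteq> r \<or> tag g (T - I) = {#} \<or>
      \<not> (cnt (nx r) (tag g (T - I)) = 0 \<and> cnt (nx (nx r)) (tag g (T - I)) = 0)"
    using assms(5) by fastforce
  have parity: "(even (cnt (nx r) (tag g I + tag g (T - I))) \<longleftrightarrow>
        even (cnt (nx (nx r)) (tag g I + tag g (T - I)))) \<and>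
      (even (cnt r (tag g I + tag g (T - I))) \<longleftrightarrow> odd (cnt (nx r) (tag g I + tag g (T - I))))"
    using assms(3) unfolding adm_def cnts cnt_simps by blast
  have parity': "(even (cnt (nx v) (tag g I)) \<longleftrightarrow> even (cnt (nx (nx v)) (tag g I))) \<and>
      (even (cnt v (tag g I)) \<longleftrightarrow> odd (cnt (nx v) (tag g I)))"
    using assms(4) unfolding adm_def by blast
  show ?thesis
  proof (cases "tag g (T - I) = {#}")
    case True
    then show ?thesis
      using parity parity' unfolding adm_def by (cases rule: z3_cases[of v r]) auto
  next
    case False
    then show ?thesis
      using parity parity' nz unfolding adm_def by (cases rule: z3_cases[of v r]) auto
  qed
qed

context nonassoc_algebra
begin

text \<open>If splitting off a leaf left a factor that drops degree, the whole product would drop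
  too; so leaves can be split off one by one down to degree \<open>m\<close>.\<close>

lemma nonzero_subtree:
  assumes "descendingly_flexible" "\<And>x. y x \<in> \<L> 1 S"
    and "ev y t \<notin> \<L> (deg t - 1) S" "1 \<le> m" "m \<le> deg t"
  shows "\<exists>t'. deg t' = m \<and> ev y t' \<notin> \<L> (m - 1) S"
  using assms(3,5)
proof (induction "deg t" arbitrary: t rule: less_induct)
  case less
  show ?case
  proof (cases "deg t = m")
    case False
    then obtain l r where "t = Node l r"
      using less.prems(2) assms(4) by (cases t) auto
    then obtain t' b where tb: "t \<simeq> Node t' (Leaf b) \<or> t \<simeq> Node (Leaf b) t'"
      using eqv_leaf_child by metis
    then have d: "deg t = Suc (deg t')" using eqv_deg by fastforce
    have "ev y t' \<notin> \<L> (deg t' - 1) S"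
    proof
      assume *: "ev y t' \<in> \<L> (deg t' - 1) S"
      have "ev y (Node t' (Leaf b)) \<in> \<L> (deg t' - 1 + 1) S"
        "ev y (Node (Leaf b) t') \<in> \<L> (1 + (deg t' - 1)) S"
        unfolding ev.simps by (intro \<L>_mult * assms(2))+
      then have "ev y t \<in> \<L> (deg t - 1) S"
        using tb ev_eqv_lower[where y = y and S = S, OF assms(1) _ assms(2), of t] deg_pos[of t'] by (auto simp: d)
      then show False using less.prems by blast
    qed
    then show ?thesis using less.hyps[of t'] d False less.prems(2) by auto
  qed (use less.prems in blast)
qed

end

context fin_dim_nonassoc_algebra
begin

lemma dim_level_ge_1:
  assumes "descendingly_flexible" "\<And>x. y x \<in> \<L> 1 S"
    and "ev y t \<notin> \<L> (deg t - 1) S" "1 \<le> m" "m \<le> deg t"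
  shows "dim (\<L> (m - 1) S) + 1 \<le> dim (\<L> m S)"
proof -
  obtain t' where t': "deg t' = m" "ev y t' \<notin> \<L> (m - 1) S"
    using nonzero_subtree[where y = y and S = S, OF assms] by blast
  have "dim (insert (ev y t') (\<L> (m - 1) S)) = Suc (dim (\<L> (m - 1) S))"
    by (rule dim_insert_functional[of id "\<L> (m - 1) S"])
      (use t' in \<open>auto simp: linear_map_def subspace_\<L>\<close>)
  moreover have "insert (ev y t') (\<L> (m - 1) S) \<subseteq> \<L> m S"
    using ev_in_\<L>[of y S t', OF assms(2)] t' \<L>_mono[of "m - 1" m S] by auto
  ultimately show ?thesis using dim_subset by (metis Suc_eq_plus1)
qed

text \<open>Here \<open>e I\<close> realizes \<open>I\<close>, and \<open>f I\<close> is its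
  complement with a hole named \<open>h\<close>. Filled with \<open>e I\<close> it has the leaves of
  \<open>t\<close>; filled with another \<open>e J\<close> it repeats a leaf, and \<open>sep\<close>
  keeps the repetition clear of the exceptional pattern of
  \<open>eqv_nil_if_duplicate\<close>.\<close>

lemma dim_level:
  assumes flex: "descendingly_flexible" and y: "\<And>x. y x \<in> \<L> 1 S"
    and T: "finite T" "leaves r t = tag g T" "ev y t \<notin> \<L> (deg t - 1) S"
    and h: "h \<notin> T" and m: "1 \<le> m"
    and F: "\<And>I. I \<in> F \<Longrightarrow> I \<subseteq> T \<and> card I = m \<and> adm v (tag g I) \<and>
              (v \<noteq> r \<or> I = T \<or> (\<exists>p\<in>T - I. g p \<noteq> r))"
    and sep: "\<And>I J. I \<in> F \<Longrightarrow> J \<in> F \<Longrightarrow> I \<noteq> J \<Longrightarrow>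
                \<exists>x\<in>J - I. g x = r \<or> (\<exists>p\<in>J \<union> (T - I) - {x}. g p \<noteq> r)"
  shows "dim (\<L> (m - 1) S) + card F \<le> dim (\<L> m S)"
proof -
  have finF: "finite F"
    using F T(1) by (meson Pow_iff finite_Pow_iff finite_subset subsetI)
  have fin: "finite I" if "I \<in> F" for I using F[OF that] T(1) finite_subset by blast
  have n: "deg t = card T" using size_leaves[of r t] T by (simp add: size_tag)
  have "\<exists>e. leaves v e = tag g I" if "I \<in> F" for I
    using adm_realizable F[OF that] by blast
  then obtain e where e: "\<And>I. I \<in> F \<Longrightarrow> leaves v (e I) = tag g I" by metis
  have "\<exists>C. leaves r C = add_mset (h, v) (tag g (T - I))" if "I \<in> F" for I
    using adm_realizable adm_context[OF T(1), of I r g v h] F[OF that] T(2)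
    by (metis adm_leaves)
  then obtain C where C: "\<And>I. I \<in> F \<Longrightarrow> leaves r (C I) = add_mset (h, v) (tag g (T - I))" by metis
  define f where "f I x = ev (y(h := x)) (C I)" for I x
  have occ: "occ h (C I) = 1" if "I \<in> F" for I
  proof -
    have "filter_mset (\<lambda>p. fst p = h) (tag g (T - I)) = {#}"
      using h T(1) by (auto simp: set_tag)
    then show ?thesis unfolding occ_leaves[of h _ r] C[OF that] by (simp del: filter_mset_eq_mempty_iff)
  qed
  have card_Diff: "card (T - I) = card T - m" if "I \<in> F" for I
    using F[OF that] fin[OF that] by (simp add: card_Diff_subset)
  have degC: "deg (C I) = card T - m + 1" if "I \<in> F" for I
    using size_leaves[of r "C I"] C[OF that] T(1) card_Diff[OF that] by (simp add: size_tag)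
  have mT: "m \<le> card T" if "I \<in> F" for I using F[OF that] T(1) card_mono by blast
  have leaves_comb: "leaves r (subst h (e J) (C I)) = tag g J + tag g (T - I)"
    if "I \<in> F" "J \<in> F" for I J
    using leaves_subst[OF C[OF that(1)], of "e J"] h T(1) e[OF that(2)] by (auto simp: set_tag)
  have deg_comb: "deg (subst h (e J) (C I)) = card T" if "I \<in> F" "J \<in> F" for I J
    using arg_cong[OF leaves_comb[OF that], of size] F[OF that(2)] T(1) fin[OF that(2)]
      mT[OF that(1)] card_Diff[OF that(1)]
    by (simp add: size_tag)
  have "dim (\<L> (m - 1) S \<union> (\<lambda>I. ev y (e I)) ` F) = dim (\<L> (m - 1) S) + card F"
  proof (rule dim_Un_functionals[OF finF, of "\<L> (card T - 1) S" f])
    fix I assume I: "I \<in> F"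
    show "linear_map (f I)" unfolding f_def by (rule linear_map_ev[OF occ[OF I]])
    have "m - 1 + deg (C I) - 1 = card T - 1" using degC[OF I] mT[OF I] m by simp
    then show "f I ` \<L> (m - 1) S \<subseteq> \<L> (card T - 1) S"
      using ev_upd_in_\<L>[of h "C I" y S _ "m - 1", OF occ[OF I] y] unfolding f_def by auto
    show "f I (ev y (e I)) \<notin> \<L> (card T - 1) S"
    proof -
      have "leaves r t = leaves r (subst h (e I) (C I))"
        unfolding leaves_comb[OF I I] T(2) using tag_Un_disjoint[of I "T - I" g] F[OF I] T(1) fin[OF I]
        by (metis Diff_disjoint Diff_partition finite_Diff)
      then have "t \<simeq> subst h (e I) (C I)" by (rule leaves_eq_imp_eqv)
      from ev_eqv_lower[where y = y and S = S, OF flex this y]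
      have "ev y (subst h (e I) (C I)) \<notin> \<L> (card T - 1) S"
        using T(3) deg_comb[OF I I] n by auto
      then show ?thesis unfolding f_def by (simp add: ev_subst)
    qed
    fix J assume J: "J \<in> F" and "I \<noteq> J"
    then obtain x where x: "x \<in> J - I" "g x = r \<or> (\<exists>p\<in>J \<union> (T - I) - {x}. g p \<noteq> r)"
      using sep[OF I J] by blast
    \<comment> \<open>As \<open>x\<close> lies both in \<open>J\<close> and in the complement of
      \<open>I\<close>, it occurs twice with label \<open>g x\<close> once \<open>e J\<close> fills
      the hole.\<close>
    have xT: "x \<in> T - I" "x \<in> J" using x(1) F[OF J] by auto
    let ?M = "tag g (J - {x}) + tag g (T - I - {x})"
    have "leaves r (subst h (e J) (C I)) = ?M + {#(x, g x), (x, g x)#}"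
      unfolding leaves_comb[OF I J] tag_remove[OF fin[OF J] xT(2)]
        tag_remove[OF finite_Diff[OF T(1)] xT(1)] by simp
    moreover have "g x = r \<or> (\<exists>p\<in>#?M. snd p \<noteq> r)"
    proof (rule disjE[OF x(2)])
      assume "\<exists>p\<in>J \<union> (T - I) - {x}. g p \<noteq> r"
      then obtain p where "p \<in> J - {x} \<or> p \<in> T - I - {x}" "g p \<noteq> r" by blast
      then have "(p, g p) \<in># ?M" "snd (p, g p) \<noteq> r"
        using fin[OF J] T(1) by (auto simp: set_tag)
      then show ?thesis by blast
    qed simp
    ultimately have "ev y (subst h (e J) (C I)) \<in> \<L> (card T - 1) S"
      using ev_duplicate[where y = y and S = S, OF flex y] deg_comb[OF I J] by metis
    then show "f I (ev y (e J)) \<in> \<L> (card T - 1) S" unfolding f_def by (simp add: ev_subst)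
  qed (rule subspace_\<L>)
  moreover have "\<L> (m - 1) S \<union> (\<lambda>I. ev y (e I)) ` F \<subseteq> \<L> m S"
  proof -
    have "ev y (e I) \<in> \<L> m S" if "I \<in> F" for I
      using ev_in_\<L>[of y S "e I", OF y] size_leaves[of v "e I"] e[OF that] F[OF that] fin[OF that]
      by (simp add: size_tag)
    then show ?thesis using \<L>_mono[of "m - 1" m S] by auto
  qed
  ultimately show ?thesis using dim_subset by metis
qed

lemma dim_level_sum:
  assumes "\<And>m. 1 \<le> m \<Longrightarrow> m \<le> n \<Longrightarrow> dim (\<L> (m - 1) S) + k m \<le> dim (\<L> m S)"
  shows "dim (\<L> 0 S) + (\<Sum>m=1..n. k m) \<le> dim (\<L> n S)"
  using assms
proof (induction n)
  case (Suc n)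
  from Suc.IH Suc.prems have "dim (\<L> 0 S) + (\<Sum>m=1..n. k m) \<le> dim (\<L> n S)" by simp
  then show ?case using Suc.prems[of "Suc n"] by simp
qed simp

text \<open>For two elements a triangular pattern suffices: \<open>f1\<close> shows that
  \<open>e1\<close> is new, and \<open>f2\<close> that \<open>e2\<close> is new even after adding
  \<open>e1\<close>.\<close>

lemma dim_level_ge_2:
  assumes "linear_map f1" "linear_map f2"
    and "f1 ` \<L> (m - 1) S \<subseteq> \<L> k S" "f2 ` \<L> (m - 1) S \<subseteq> \<L> k S"
    and "e1 \<in> \<L> m S" "e2 \<in> \<L> m S"
    and "f1 e1 \<notin> \<L> k S" "f2 e1 \<in> \<L> k S" "f2 e2 \<notin> \<L> k S"
  shows "dim (\<L> (m - 1) S) + 2 \<le> dim (\<L> m S)"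
proof -
  let ?X = "\<L> (m - 1) S"
  have "dim (insert e1 ?X) = Suc (dim ?X)"
    using assms by (intro dim_insert_functional[OF _ subspace_\<L>[of k S]])
  moreover have "dim (insert e2 (insert e1 ?X)) = Suc (dim (insert e1 ?X))"
    using assms by (intro dim_insert_functional[OF assms(2) subspace_\<L>[of k S]]) auto
  moreover have "insert e2 (insert e1 ?X) \<subseteq> \<L> m S"
    using assms \<L>_mono[of "m - 1" m S] by auto
  ultimately show ?thesis using dim_subset by (metis add_2_eq_Suc')
qed

end

section \<open>Counting realizable sets of leaves\<close>

lemma exists_distinct_labels:
  assumes "finite T" "adm r (tag g T)" "2 \<le> card T"
  obtains i j where "i \<in> T" "j \<in> T" "g i \<noteq> g j"
proof -
  have "T \<noteq> {}" using assms(3) by auto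
  then obtain i where i: "i \<in> T" by blast
  have "\<exists>j\<in>T. g j \<noteq> g i"
  proof (rule ccontr)
    assume "\<not> ?thesis"
    then have "{j \<in> T. g j = c} = (if c = g i then T else {})" for c by auto
    then have "cnt c (tag g T) = (if c = g i then card T else 0)" for c
      using cnt_tag[OF assms(1)] by simp
    then show False
      using assms(2,3) unfolding adm_def by (auto split: if_splits)
  qed
  then show ?thesis using i that by metis
qed

text \<open>The part of \<open>adm\<close> that is affine over the field of two elements, and hence
  easy to count.\<close>

definition parity_ok :: "z3 \<Rightarrow> ('b \<times> z3) multiset \<Rightarrow> bool" where
  "parity_ok r M \<longleftrightarrow>
     (even (cnt (nx r) M) \<longleftrightarrow> even (cnt (nx (nx r)) M)) \<and> (even (cnt r M) \<longleftrightarrow> odd (cnt (nx r) M))"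

lemma adm_parity: "adm v M \<Longrightarrow> parity_ok v M"
  unfolding adm_def parity_ok_def by blast

text \<open>The three labels change the two parity conditions in the three nonzero ways, so two
  differently labelled leaves \<open>i\<close>, \<open>j\<close> can correct every choice
  \<open>J\<close> of the other leaves.\<close>

lemma card_parity_ok:
  assumes "finite T" "i \<in> T" "j \<in> T" "g i \<noteq> g j"
  shows "2 ^ (card T - 2) \<le> card {I \<in> Pow T. parity_ok r (tag g I)}"
proof -
  let ?P = "{I \<in> Pow T. parity_ok r (tag g I)}" and ?U = "T - {i, j}"
  have ij: "i \<noteq> j" using assms by auto
  have "\<exists>K. K \<subseteq> {i, j} \<and> parity_ok r (tag g (K \<union> J))" if "J \<subseteq> ?U" for J
  proof -
    have J: "finite J" "i \<notin> J" "j \<notin> J"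
      using that assms(1) finite_subset by auto
    let ?M = "tag g J"
    have "parity_ok r ?M \<or> parity_ok r (add_mset (i, g i) ?M) \<or> parity_ok r (add_mset (j, g j) ?M)
        \<or> parity_ok r (add_mset (i, g i) (add_mset (j, g j) ?M))"
      using assms(4) unfolding parity_ok_def
      by (cases rule: z3_cases[of "g i" r]; cases rule: z3_cases[of "g j" r]) auto
    moreover have "tag g ({i} \<union> J) = add_mset (i, g i) ?M" "tag g ({j} \<union> J) = add_mset (j, g j) ?M"
      "tag g ({i, j} \<union> J) = add_mset (i, g i) (add_mset (j, g j) ?M)" "tag g ({} \<union> J) = ?M"
      using J ij by auto
    ultimately have "parity_ok r (tag g ({} \<union> J)) \<or> parity_ok r (tag g ({i} \<union> J)) \<or>
        parity_ok r (tag g ({j} \<union> J)) \<or> parity_ok r (tag g ({i, j} \<union> J))"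
      by (simp only:)
    then show ?thesis by blast
  qed
  then obtain K where K: "\<And>J. J \<subseteq> ?U \<Longrightarrow> K J \<subseteq> {i, j} \<and> parity_ok r (tag g (K J \<union> J))"
    by metis
  have "card (Pow ?U) \<le> card ?P"
  proof (rule card_inj_on_le)
    show "inj_on (\<lambda>J. K J \<union> J) (Pow ?U)"
    proof (rule inj_on_inverseI)
      fix J assume "J \<in> Pow ?U"
      then show "(K J \<union> J) - {i, j} = J" using K[of J] by blast
    qed
    show "(\<lambda>J. K J \<union> J) ` Pow ?U \<subseteq> ?P"
    proof (rule image_subsetI)
      fix J assume "J \<in> Pow ?U"
      then show "K J \<union> J \<in> ?P" using K[of J] assms(2,3) by auto
    qed
  qed (use assms(1) in simp)
  moreover have "card (Pow ?U) = 2 ^ (card T - 2)"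
    using assms ij by (simp add: card_Pow card_Diff_subset)
  ultimately show ?thesis by simp
qed

lemma card_subsets_ge_2:
  assumes "finite A"
  shows "card {C \<in> Pow A. 2 \<le> card C} + card A + 1 = 2 ^ card A"
proof -
  have split: "Pow A = {C \<in> Pow A. 2 \<le> card C} \<union> (\<lambda>x. {x}) ` A \<union> {{}}"
  proof -
    have "C = {} \<or> (\<exists>x\<in>A. C = {x})" if "C \<subseteq> A" "\<not> 2 \<le> card C" for C
    proof -
      have "card C = 0 \<or> card C = 1" using that(2) by linarith
      then show ?thesis
        using that(1) assms finite_subset by (auto simp: card_1_singleton_iff)
    qed
    then show ?thesis by auto
  qed
  have "card (Pow A) = card ({C \<in> Pow A. 2 \<le> card C} \<union> (\<lambda>x. {x}) ` A) + card {{} :: 'a set}"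
    by (subst split, rule card_Un_disjoint) (use assms in auto)
  also have "card ({C \<in> Pow A. 2 \<le> card C} \<union> (\<lambda>x. {x}) ` A) =
      card {C \<in> Pow A. 2 \<le> card C} + card ((\<lambda>x. {x}) ` A)"
    by (rule card_Un_disjoint) (use assms in auto)
  also have "card ((\<lambda>x. {x}) ` A) = card A" by (rule card_image) simp
  finally show ?thesis using assms by (simp add: card_Pow)
qed

lemma cnt_tag_zero: "finite I \<Longrightarrow> cnt c (tag g I) = 0 \<longleftrightarrow> (\<forall>i\<in>I. g i \<noteq> c)"
  using cnt_tag_pos[of I c g] by auto

lemma cnt_tag_other_zero:
  assumes "finite I"
  shows "cnt (nx r) (tag g I) = 0 \<and> cnt (nx (nx r)) (tag g I) = 0 \<longleftrightarrow> (\<forall>i\<in>I. g i = r)"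
proof -
  have "c \<noteq> nx r \<and> c \<noteq> nx (nx r) \<longleftrightarrow> c = r" for c by (cases rule: z3_cases[of c r]) auto
  then show ?thesis unfolding cnt_tag_zero[OF assms] by blast
qed

text \<open>A set with correct parities is lost for one of two reasons: it consists of root-labelled
  leaves, an odd number and at least 3, or its complement does, with a positive even number. Both
  kinds together inject into the subsets of size at least 2 of the \<open>k\<close> root-labelled
  leaves.\<close>

lemma card_good_subsets:
  fixes g :: "'b \<Rightarrow> z3"
  assumes T: "finite T" "adm r (tag g T)" "2 \<le> card T" and nonroot: "\<exists>p\<in>T. g p \<noteq> r"
  defines "F \<equiv> {I \<in> Pow T. adm r (tag g I) \<and> (I = T \<or> (\<exists>p\<in>T - I. g p \<noteq> r))}"
    and "k \<equiv> card {i \<in> T. g i = r}"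
  shows "2 ^ (card T - 2) + k + 1 \<le> card F + 2 ^ k"
proof -
  let ?R = "{i \<in> T. g i = r}" and ?P = "{I \<in> Pow T. parity_ok r (tag g I)}"
  let ?Q = "{C \<in> Pow ?R. 2 \<le> card C}"
  obtain i j where "i \<in> T" "j \<in> T" "g i \<noteq> g j" by (rule exists_distinct_labels[OF T])
  then have P: "2 ^ (card T - 2) \<le> card ?P" by (rule card_parity_ok[OF T(1)])
  have par: "parity_ok r (tag g T)" using adm_parity T(2) by blast
  have rooted: "cnt r (tag g I) = card I" "cnt (nx r) (tag g I) = 0" "cnt (nx (nx r)) (tag g I) = 0"
    if "I \<subseteq> ?R" for I
  proof -
    have fin: "finite I" using that T(1) by (simp add: finite_subset)
    have "\<forall>i\<in>I. g i = r" using that by blast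
    then show "cnt (nx r) (tag g I) = 0" "cnt (nx (nx r)) (tag g I) = 0"
      using cnt_tag_other_zero[OF fin] by blast+
    show "cnt r (tag g I) = card I"
      using that by (auto simp: cnt_tag[OF fin] intro!: arg_cong[of _ _ card])
  qed
  \<comment> \<open>Sets of the first kind are kept, those of the second are replaced by their
    complements; the parity of the size tells the images apart.\<close>
  define \<phi> where "\<phi> I = (if I \<subseteq> ?R then I else T - I)" for I
  have bad: "(I \<subseteq> ?R \<and> odd (card I) \<and> 2 \<le> card I) \<or>
      (\<not> I \<subseteq> ?R \<and> T - I \<subseteq> ?R \<and> even (card (T - I)) \<and> 2 \<le> card (T - I))"
    if "I \<in> ?P - F" for I
  proof (cases "I \<subseteq> ?R")
    case True
    have ok: "parity_ok r (tag g I)" and IT: "I \<subseteq> T" using that by auto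
    have odd: "odd (card I)" using ok rooted[OF True] unfolding parity_ok_def by simp
    have "card I \<noteq> 1"
    proof
      assume "card I = 1"
      then have "adm r (tag g I)" using ok rooted[OF True] unfolding adm_def parity_ok_def by simp
      moreover have "\<exists>p\<in>T - I. g p \<noteq> r" using nonroot True by blast
      ultimately show False using that unfolding F_def by blast
    qed
    with odd have "2 \<le> card I" by (cases "card I") auto
    then show ?thesis using odd True by blast
  next
    case False
    have ok: "parity_ok r (tag g I)" and IT: "I \<subseteq> T" using that by auto
    have fin: "finite I" using IT T(1) finite_subset by blast
    have "\<not> (\<forall>i\<in>I. g i = r)" using False IT by blast
    then have "adm r (tag g I)"
      using ok cnt_tag_other_zero[OF fin, of r g] unfolding adm_def parity_ok_def by blast
    then have sub: "T - I \<subseteq> ?R" and ne: "T - I \<noteq> {}" using that unfolding F_def by auto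
    have "even (card (T - I))"
      using ok par rooted[OF sub] cnt_tag_Diff[OF T(1) IT, of r g] cnt_tag_Diff[OF T(1) IT, of "nx r" g]
      unfolding parity_ok_def by auto
    moreover have "0 < card (T - I)" using ne T(1) by (simp add: card_gt_0_iff)
    ultimately have "even (card (T - I)) \<and> 2 \<le> card (T - I)" by presburger
    then show ?thesis using False sub by blast
  qed
  have "card (?P - F) \<le> card ?Q"
  proof (rule card_inj_on_le)
    show "inj_on \<phi> (?P - F)"
    proof (rule inj_onI)
      fix I J assume IJ: "I \<in> ?P - F" "J \<in> ?P - F" "\<phi> I = \<phi> J"
      then have "I \<subseteq> T" "J \<subseteq> T" by auto
      then show "I = J"
        using bad[OF IJ(1)] bad[OF IJ(2)] IJ(3) unfolding \<phi>_def by (auto split: if_splits)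
    qed
    show "\<phi> ` (?P - F) \<subseteq> ?Q"
      using bad unfolding \<phi>_def by (auto split: if_splits)
  qed (use T(1) in simp)
  moreover have "card ?P = card F + card (?P - F)"
  proof -
    have "F \<subseteq> ?P" unfolding F_def using adm_parity by blast
    moreover have "finite ?P" using T(1) by simp
    ultimately show ?thesis
      using card_Diff_subset[of F ?P] card_mono[of ?P F] finite_subset by fastforce
  qed
  moreover have "card ?Q + k + 1 = 2 ^ k"
    unfolding k_def by (rule card_subsets_ge_2) (use T(1) in simp)
  ultimately show ?thesis using P by linarith
qed

lemma sum_card_levels:
  assumes "finite T"
  shows "(\<Sum>m\<le>card T. card {I \<in> Pow T. card I = m \<and> P I}) = card {I \<in> Pow T. P I}"
proof -
  have "{I \<in> Pow T. P I} = (\<Union>m\<le>card T. {I \<in> Pow T. card I = m \<and> P I})"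
    using assms by (auto intro: card_mono)
  also have "card \<dots> = (\<Sum>m\<le>card T. card {I \<in> Pow T. card I = m \<and> P I})"
    by (rule card_UN_disjoint) (use assms in auto)
  finally show ?thesis by simp
qed

text \<open>Shows that the loss \<open>2 ^ k - k - 1\<close> is worst for the largest possible
  \<open>k\<close>; stated additively because subtraction on naturals truncates.\<close>

lemma pow2_minus_mono: "k \<le> l \<Longrightarrow> (2::nat) ^ k + l \<le> 2 ^ l + k"
proof (induction rule: dec_induct)
  case (step m)
  have "(1::nat) \<le> 2 ^ m" by simp
  then show ?case using step.IH unfolding power_Suc by linarith
qed simp

context nonassoc_algebra
begin

lemma \<L>_cancel:
  assumes "a + b \<in> \<L> k S"
  shows "a \<in> \<L> k S \<longleftrightarrow> b \<in> \<L> k S"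
  using subspace_diff[OF subspace_\<L> assms, of a] subspace_diff[OF subspace_\<L> assms, of b] by auto

lemma linear_map_compose: "linear_map f \<Longrightarrow> linear_map h \<Longrightarrow> linear_map (\<lambda>x. f (h x))"
  unfolding linear_map_def by simp

end

section \<open>Growth of the low levels, from products of degree 3 and 4\<close>

context fin_dim_nonassoc_algebra
begin

text \<open>If (xy)z keeps its degree, so does (zy)x, whereas (xy)x drops. Hence multiplications
  separate \<open>x\<close> from \<open>z\<close> in level 1 and xy from zy in level 2. The product
  x(yz) is treated in the mirrored way.\<close>

lemma dim_levels_of_degree_3:
  assumes flex: "descendingly_flexible"
    and xyz: "x \<in> \<L> 1 S" "y \<in> \<L> 1 S" "z \<in> \<L> 1 S"
    and nz: "(x \<cdot> y) \<cdot> z \<notin> \<L> 2 S \<or> x \<cdot> (y \<cdot> z) \<notin> \<L> 2 S"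
  shows "dim (\<L> 0 S) + 2 \<le> dim (\<L> 1 S) \<and> dim (\<L> 1 S) + 2 \<le> dim (\<L> 2 S)"
proof -
  have m01: "b \<in> \<L> 1 S \<Longrightarrow> a \<in> \<L> 0 S \<Longrightarrow> a \<cdot> b \<in> \<L> 1 S \<and> b \<cdot> a \<in> \<L> 1 S" for a b
    using \<L>_mult[of a 0 S b 1] \<L>_mult[of b 1 S a 0] by simp
  have m11: "a \<in> \<L> 1 S \<Longrightarrow> b \<in> \<L> 1 S \<Longrightarrow> a \<cdot> b \<in> \<L> 2 S" for a b
    using \<L>_mult[of a 1 S b 1] by (simp add: numeral_2_eq_2)
  have nil: "(a \<cdot> b) \<cdot> a \<in> \<L> 2 S" "a \<cdot> (b \<cdot> a) \<in> \<L> 2 S" if "a \<in> \<L> 1 S" "b \<in> \<L> 1 S" for a b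
    using flexible_nil[OF flex that] by (simp_all add: numeral_2_eq_2)
  have fin: "dim (\<L> 0 S) + 2 \<le> dim (\<L> 1 S)"
    if "linear_map f1" "linear_map f2" "f1 ` \<L> 0 S \<subseteq> \<L> 2 S" "f2 ` \<L> 0 S \<subseteq> \<L> 2 S"
      "e1 \<in> \<L> 1 S" "e2 \<in> \<L> 1 S" "f1 e1 \<notin> \<L> 2 S" "f2 e1 \<in> \<L> 2 S" "f2 e2 \<notin> \<L> 2 S" for f1 f2 e1 e2
    using dim_level_ge_2[of f1 f2 1 S 2 e1 e2] that by simp
  have fin2: "dim (\<L> 1 S) + 2 \<le> dim (\<L> 2 S)"
    if "linear_map f1" "linear_map f2" "f1 ` \<L> 1 S \<subseteq> \<L> 2 S" "f2 ` \<L> 1 S \<subseteq> \<L> 2 S"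
      "e1 \<in> \<L> 2 S" "e2 \<in> \<L> 2 S" "f1 e1 \<notin> \<L> 2 S" "f2 e1 \<in> \<L> 2 S" "f2 e2 \<notin> \<L> 2 S" for f1 f2 e1 e2
    using dim_level_ge_2[of f1 f2 2 S 2 e1 e2] that by simp
  from nz show ?thesis
  proof
    assume *: "(x \<cdot> y) \<cdot> z \<notin> \<L> 2 S"
    have swap: "(x \<cdot> y) \<cdot> z + (z \<cdot> y) \<cdot> x \<in> \<L> 2 S"
      using flexible_swap(1)[OF flex xyz] by (simp add: numeral_2_eq_2)
    then have **: "(z \<cdot> y) \<cdot> x \<notin> \<L> 2 S" using * \<L>_cancel by blast
    have "linear_map (\<lambda>u. (u \<cdot> y) \<cdot> c)" for c
      by (rule linear_map_compose[of "\<lambda>v. v \<cdot> c"]) simp_all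
    moreover have "(\<lambda>u. (u \<cdot> y) \<cdot> c) ` \<L> 0 S \<subseteq> \<L> 2 S" if "c \<in> \<L> 1 S" for c
      using m01[OF xyz(2)] m11[OF _ that] by blast
    ultimately have "dim (\<L> 0 S) + 2 \<le> dim (\<L> 1 S)"
      using fin[of "\<lambda>u. (u \<cdot> y) \<cdot> z" "\<lambda>u. (u \<cdot> y) \<cdot> x" x z] xyz * ** nil by blast
    moreover have "dim (\<L> 1 S) + 2 \<le> dim (\<L> 2 S)"
      using fin2[of "\<lambda>u. u \<cdot> z" "\<lambda>u. u \<cdot> x" "x \<cdot> y" "z \<cdot> y"] xyz * ** nil m11
        linear_map_mult by blast
    ultimately show ?thesis by blast
  next
    assume *: "x \<cdot> (y \<cdot> z) \<notin> \<L> 2 S"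
    have swap: "x \<cdot> (y \<cdot> z) + z \<cdot> (y \<cdot> x) \<in> \<L> 2 S"
      using flexible_swap(2)[OF flex xyz] by (simp add: numeral_2_eq_2)
    then have **: "z \<cdot> (y \<cdot> x) \<notin> \<L> 2 S" using * \<L>_cancel by blast
    have "linear_map (\<lambda>u. c \<cdot> (y \<cdot> u))" for c
      by (rule linear_map_compose[of "\<lambda>v. c \<cdot> v"]) simp_all
    moreover have "(\<lambda>u. c \<cdot> (y \<cdot> u)) ` \<L> 0 S \<subseteq> \<L> 2 S" if "c \<in> \<L> 1 S" for c
      using m01[OF xyz(2)] m11[OF that] by blast
    ultimately have "dim (\<L> 0 S) + 2 \<le> dim (\<L> 1 S)"
      using fin[of "\<lambda>u. x \<cdot> (y \<cdot> u)" "\<lambda>u. z \<cdot> (y \<cdot> u)" z x] xyz * ** nil by blast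
    moreover have "dim (\<L> 1 S) + 2 \<le> dim (\<L> 2 S)"
      using fin2[of "\<lambda>u. x \<cdot> u" "\<lambda>u. z \<cdot> u" "y \<cdot> z" "y \<cdot> x"] xyz * ** nil m11
        linear_map_mult by blast
    ultimately show ?thesis by blast
  qed
qed

text \<open>Exchanges keep each of the shapes (a(bc))d and d((bc)a), and connect the other three
  shapes of degree 4 with one another. In the first two shapes, exchanging \<open>a\<close> and
  \<open>d\<close> gives the two new elements.\<close>

lemma dim_level_3_of_degree_4:
  assumes flex: "descendingly_flexible" and y: "\<And>x. y x \<in> \<L> 1 S"
    and nz: "ev y t \<notin> \<L> 3 S" and deg: "deg t = 4"
  shows "dim (\<L> 2 S) + 2 \<le> dim (\<L> 3 S)"
proof -
  have m11: "a \<in> \<L> 1 S \<Longrightarrow> b \<in> \<L> 1 S \<Longrightarrow> a \<cdot> b \<in> \<L> 2 S" for a b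
    using \<L>_mult[of a 1 S b 1] by (simp add: numeral_2_eq_2)
  have m21: "a \<in> \<L> 2 S \<Longrightarrow> b \<in> \<L> 1 S \<Longrightarrow> a \<cdot> b \<in> \<L> 3 S \<and> b \<cdot> a \<in> \<L> 3 S" for a b
    using \<L>_mult[of a 2 S b 1] \<L>_mult[of b 1 S a 2] by (simp add: numeral_3_eq_3)
  have nil: "(a \<cdot> b) \<cdot> a \<in> \<L> 3 S" "a \<cdot> (b \<cdot> a) \<in> \<L> 3 S" if "a \<in> \<L> 1 S" "b \<in> \<L> 2 S" for a b
    using flexible_nil[OF flex that] by (simp_all add: numeral_3_eq_3)
  have swap: "(a \<cdot> b) \<cdot> c + (c \<cdot> b) \<cdot> a \<in> \<L> 3 S" "a \<cdot> (b \<cdot> c) + c \<cdot> (b \<cdot> a) \<in> \<L> 3 S"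
    if "a \<in> \<L> i S" "b \<in> \<L> j S" "c \<in> \<L> k S" "i + j + k = 4" "1 \<le> i" "1 \<le> j" "1 \<le> k" for a b c i j k
    using flexible_swap[OF flex that(1-3,5-7)] that(4) by simp_all
  have fin: ?thesis
    if "linear_map f1" "linear_map f2" "f1 ` \<L> 2 S \<subseteq> \<L> 3 S" "f2 ` \<L> 2 S \<subseteq> \<L> 3 S"
      "e1 \<in> \<L> 3 S" "e2 \<in> \<L> 3 S" "f1 e1 \<notin> \<L> 3 S" "f2 e1 \<in> \<L> 3 S" "f2 e2 \<notin> \<L> 3 S" for f1 f2 e1 e2
    using dim_level_ge_2[of f1 f2 3 S 3 e1 e2] that by simp
  show ?thesis
  proof (cases "\<exists>a\<in>\<L> 1 S. \<exists>b\<in>\<L> 1 S. \<exists>c\<in>\<L> 1 S. \<exists>d\<in>\<L> 1 S.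
      (a \<cdot> (b \<cdot> c)) \<cdot> d \<notin> \<L> 3 S \<or> d \<cdot> ((b \<cdot> c) \<cdot> a) \<notin> \<L> 3 S")
    case True
    then obtain a b c d where abcd: "a \<in> \<L> 1 S" "b \<in> \<L> 1 S" "c \<in> \<L> 1 S" "d \<in> \<L> 1 S"
      and "(a \<cdot> (b \<cdot> c)) \<cdot> d \<notin> \<L> 3 S \<or> d \<cdot> ((b \<cdot> c) \<cdot> a) \<notin> \<L> 3 S" by blast
    note bc = m11[OF abcd(2,3)]
    from \<open>_ \<or> _\<close> show ?thesis
    proof
      assume *: "(a \<cdot> (b \<cdot> c)) \<cdot> d \<notin> \<L> 3 S"
      then have "(d \<cdot> (b \<cdot> c)) \<cdot> a \<notin> \<L> 3 S"
        using \<L>_cancel[OF swap(1)[OF abcd(1) bc abcd(4)]] by simp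
      with * show ?thesis
        by (intro fin[of "\<lambda>u. u \<cdot> d" "\<lambda>u. u \<cdot> a" "a \<cdot> (b \<cdot> c)" "d \<cdot> (b \<cdot> c)"])
          (use m21 abcd bc nil in auto)
    next
      assume *: "d \<cdot> ((b \<cdot> c) \<cdot> a) \<notin> \<L> 3 S"
      then have "a \<cdot> ((b \<cdot> c) \<cdot> d) \<notin> \<L> 3 S"
        using \<L>_cancel[OF swap(2)[OF abcd(4) bc abcd(1)]] by simp
      with * show ?thesis
        by (intro fin[of "\<lambda>u. d \<cdot> u" "\<lambda>u. a \<cdot> u" "(b \<cdot> c) \<cdot> a" "(b \<cdot> c) \<cdot> d"])
          (use m21 abcd bc nil in auto)
    qed
  next
    case False
    \<comment> \<open>The three remaining shapes are connected by exchanges, so if ((ab)c)d always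
      dropped degree, all five shapes would, and with them \<open>t\<close>.\<close>
    have "\<exists>a\<in>\<L> 1 S. \<exists>b\<in>\<L> 1 S. \<exists>c\<in>\<L> 1 S. \<exists>d\<in>\<L> 1 S. ((a \<cdot> b) \<cdot> c) \<cdot> d \<notin> \<L> 3 S"
    proof (rule ccontr)
      assume "\<not> ?thesis"
      then have comb: "((a \<cdot> b) \<cdot> c) \<cdot> d \<in> \<L> 3 S"
        if "a \<in> \<L> 1 S" "b \<in> \<L> 1 S" "c \<in> \<L> 1 S" "d \<in> \<L> 1 S" for a b c d
        using that by blast
      have bal: "(a \<cdot> b) \<cdot> (c \<cdot> d) \<in> \<L> 3 S"
        if "a \<in> \<L> 1 S" "b \<in> \<L> 1 S" "c \<in> \<L> 1 S" "d \<in> \<L> 1 S" for a b c d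
        using \<L>_cancel[OF swap(1)[OF that(1,2) m11[OF that(3,4)]]] comb that by simp
      have rcomb: "a \<cdot> (b \<cdot> (c \<cdot> d)) \<in> \<L> 3 S"
        if "a \<in> \<L> 1 S" "b \<in> \<L> 1 S" "c \<in> \<L> 1 S" "d \<in> \<L> 1 S" for a b c d
        using \<L>_cancel[OF swap(2)[OF that(1,2) m11[OF that(3,4)]]] bal that by simp
      have mid: "(a \<cdot> (b \<cdot> c)) \<cdot> d \<in> \<L> 3 S" "d \<cdot> ((b \<cdot> c) \<cdot> a) \<in> \<L> 3 S"
        if "a \<in> \<L> 1 S" "b \<in> \<L> 1 S" "c \<in> \<L> 1 S" "d \<in> \<L> 1 S" for a b c d
        using False that by blast+
      have "\<exists>a b c d. ev y t \<in> {((y a \<cdot> y b) \<cdot> y c) \<cdot> y d, (y a \<cdot> (y b \<cdot> y c)) \<cdot> y d,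
          (y a \<cdot> y b) \<cdot> (y c \<cdot> y d), y a \<cdot> ((y b \<cdot> y c) \<cdot> y d), y a \<cdot> (y b \<cdot> (y c \<cdot> y d))}"
      proof -
        have d1: "\<exists>x. u = Leaf x" if "deg u = 1" for u :: "'b tree"
        proof (cases u)
          case (Node p q)
          then have "deg p + deg q = 1" using that by simp
          then show ?thesis using deg_pos[of p] deg_pos[of q] by arith
        qed simp
        have d2: "\<exists>a b. u = Node (Leaf a) (Leaf b)" if "deg u = 2" for u :: "'b tree"
        proof (cases u)
          case (Node p q)
          then have "deg p + deg q = 2" using that by simp
          then have "deg p = 1 \<and> deg q = 1" using deg_pos[of p] deg_pos[of q] by arith
          then show ?thesis using d1 Node by metis
        qed (use that in simp)
        have d3: "\<exists>a b c. u = Node (Node (Leaf a) (Leaf b)) (Leaf c) \<or> u = Node (Leaf a) (Node (Leaf b) (Leaf c))"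
          if "deg u = 3" for u :: "'b tree"
        proof (cases u)
          case (Node p q)
          then have "deg p + deg q = 3" using that by simp
          then have "deg p = 1 \<and> deg q = 2 \<or> deg p = 2 \<and> deg q = 1"
            using deg_pos[of p] deg_pos[of q] by arith
          then show ?thesis using d1 d2 Node by metis
        qed (use that in simp)
        obtain p q where t: "t = Node p q" using deg by (cases t) auto
        then have "deg p + deg q = 4" using deg by simp
        then consider "deg p = 1" "deg q = 3" | "deg p = 2" "deg q = 2" | "deg p = 3" "deg q = 1"
          using deg_pos[of p] deg_pos[of q] by arith
        then show ?thesis
        proof cases
          case 1
          then show ?thesis using d1[of p] d3[of q] t by fastforce
        next
          case 2
          then show ?thesis using d2[of p] d2[of q] t by fastforce
        next
          case 3
          then show ?thesis using d3[of p] d1[of q] t by fastforce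
        qed
      qed
      then show False
        using nz comb[OF y y y y] rcomb[OF y y y y] bal[OF y y y y] mid[OF y y y y] by auto
    qed
    then obtain a b c d where abcd: "a \<in> \<L> 1 S" "b \<in> \<L> 1 S" "c \<in> \<L> 1 S" "d \<in> \<L> 1 S"
      and *: "((a \<cdot> b) \<cdot> c) \<cdot> d \<notin> \<L> 3 S" by blast
    \<comment> \<open>Two exchanges lead from ((ab)c)d to b(a(dc)). The separating maps are
      multiplication by \<open>b\<close> on the left and by \<open>d\<close> on the right; the
      latter lowers a(dc), because the first case is excluded.\<close>
    have "(d \<cdot> c) \<cdot> (a \<cdot> b) \<notin> \<L> 3 S"
      using * \<L>_cancel[OF swap(1)[OF m11[OF abcd(1,2)] abcd(3,4)]] by simp
    then have "b \<cdot> (a \<cdot> (d \<cdot> c)) \<notin> \<L> 3 S"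
      using \<L>_cancel[OF swap(2)[OF m11[OF abcd(4,3)] abcd(1,2)]] by simp
    moreover have "(a \<cdot> (d \<cdot> c)) \<cdot> d \<in> \<L> 3 S" using False abcd by blast
    ultimately show ?thesis using *
      by (intro fin[of "\<lambda>u. b \<cdot> u" "\<lambda>u. u \<cdot> d" "a \<cdot> (d \<cdot> c)" "(a \<cdot> b) \<cdot> c"])
        (use m21 m11 abcd in auto)
  qed
qed

end

section \<open>The dimension bound\<close>

lemma pow2_diff_2:
  assumes "4 \<le> n"
  shows "(2::nat) ^ (n - 2) = 4 * 2 ^ (n - 4)"
proof -
  have "n - 2 = Suc (Suc (n - 4))" using assms by linarith
  then show ?thesis by simp
qed

section \<open>Words as bracketings with numbered leaves\<close>

lemma set_tree_leaves: "set_tree t = fst ` set_mset (leaves v t)"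
  by (induction t arbitrary: v) (auto simp: image_Un)

text \<open>Numbering makes the leaves distinct even if generators repeat; \<open>y\<close> recovers
  the generator and \<open>g\<close> the label. The offset \<open>k\<close> gives the two factors
  adjacent intervals, and outside the interval \<open>y\<close> still takes values among the
  generators used.\<close>

lemma relabel_leaves:
  "\<exists>t' (y :: nat \<Rightarrow> 'b) g. map_tree y t' = t \<and> leaves v t' = tag g {k..<k + deg t} \<and> range y \<subseteq> set_tree t"
proof (induction t arbitrary: v k)
  case (Leaf x)
  show ?case
    by (rule exI[of _ "Leaf k"], rule exI[of _ "\<lambda>_. x"], rule exI[of _ "\<lambda>_. v"]) auto
next
  case (Node l r)
  obtain l' y1 g1 where l: "map_tree y1 l' = l"
    "leaves (nx (nx v)) l' = tag g1 {k..<k + deg l}" "range y1 \<subseteq> set_tree l"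
    using Node.IH(1) by blast
  obtain r' y2 g2 where r: "map_tree y2 r' = r"
    "leaves (nx v) r' = tag g2 {k + deg l..<k + deg l + deg r}" "range y2 \<subseteq> set_tree r"
    using Node.IH(2) by blast
  define y where "y i = (if i < k + deg l then y1 i else y2 i)" for i
  define g where "g i = (if i < k + deg l then g1 i else g2 i)" for i
  have sl: "set_tree l' = {k..<k + deg l}"
    using l(2) by (auto simp: set_tree_leaves[of _ "nx (nx v)"] set_tag image_image)
  have sr: "set_tree r' = {k + deg l..<k + deg l + deg r}"
    using r(2) by (auto simp: set_tree_leaves[of _ "nx v"] set_tag image_image)
  have "map_tree y l' = l" "map_tree y r' = r"
    unfolding l(1)[symmetric] r(1)[symmetric]
    by (rule tree.map_cong0; auto simp: sl sr y_def)+
  moreover have "leaves (nx (nx v)) l' = tag g {k..<k + deg l}"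
    unfolding l(2) tag_def by (rule image_mset_cong) (simp add: g_def)
  moreover have "leaves (nx v) r' = tag g {k + deg l..<k + deg l + deg r}"
    unfolding r(2) tag_def by (rule image_mset_cong) (simp add: g_def)
  moreover have "tag g {k..<k + deg l} + tag g {k + deg l..<k + deg l + deg r} =
      tag g {k..<k + deg (Node l r)}"
    by (subst tag_Un_disjoint[symmetric]) (auto simp: ivl_disj_un add.assoc)
  moreover have "range y \<subseteq> set_tree (Node l r)"
    using l(3) r(3) by (auto simp: y_def)
  ultimately show ?case
    by (intro exI[of _ "Node l' r'"] exI[of _ y] exI[of _ g]) simp
qed

context nonassoc_algebra
begin

lemma ev_map_tree: "ev y (map_tree f t) = ev (\<lambda>x. y (f x)) t"
  by (induction t) auto

lemma word_imp_tree: "word S i w \<Longrightarrow> 1 \<le> i \<Longrightarrow> \<exists>t. deg t = i \<and> set_tree t \<subseteq> S \<and> ev (\<lambda>x. x) t = w"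
proof (induction rule: word.induct)
  case (word_generator s)
  then show ?case by (intro exI[of _ "Leaf s"]) simp
next
  case (word_mult i u j v)
  then obtain t t' where "deg t = i \<and> set_tree t \<subseteq> S \<and> ev (\<lambda>x. x) t = u"
    "deg t' = j \<and> set_tree t' \<subseteq> S \<and> ev (\<lambda>x. x) t' = v" by blast
  then show ?case by (intro exI[of _ "Node t t'"]) simp
qed simp

lemma word_imp_labelled_tree:
  assumes "word S n w" "1 \<le> n"
  obtains t :: "nat tree" and y g where "\<And>i. y i \<in> S" "leaves v t = tag g {0..<n}" "ev y t = w"
proof -
  obtain s where s: "deg s = n" "set_tree s \<subseteq> S" "ev (\<lambda>x. x) s = w"
    using word_imp_tree[OF assms] by blast
  obtain t y g where t: "map_tree y t = s" "leaves v t = tag g {0..<0 + deg s}" "range y \<subseteq> set_tree s"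
    using relabel_leaves[of s v 0] by blast
  show ?thesis
  proof (rule that[of y t g])
    show "y i \<in> S" for i using t(3) s(2) by blast
    show "leaves v t = tag g {0..<n}" using t(2) s(1) by simp
    show "ev y t = w" using s(3) t(1) ev_map_tree[of "\<lambda>x. x" y t] by simp
  qed
qed

end

context fin_dim_nonassoc_algebra
begin

text \<open>A proper subspace exists, so the algebra is nonzero, and a unity is then a nonzero
  element of level 0.\<close>

lemma d0_le_dim:
  assumes "\<L> k S \<noteq> UNIV"
  shows "d0 \<le> dim (\<L> 0 S)"
proof (cases unital)
  case True
  then obtain e where e: "e \<in> unity" unfolding unital_def by blast
  have "e \<noteq> 0"
  proof
    assume "e = 0"
    then have "x = 0" for x :: 'a using e mult_zero(1)[of x] unfolding unity_def by auto
    then show False using assms subspace_0[OF subspace_\<L>[of k S]] by (metis UNIV_eq_I)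
  qed
  then have "dim {e} = 1" by (simp add: dim_insert)
  moreover have "{e} \<subseteq> \<L> 0 S" using unity_in_\<L> e by blast
  ultimately have "1 \<le> dim (\<L> 0 S)" using dim_subset by metis
  then show ?thesis unfolding d0_def by simp
qed (simp add: d0_def)

section \<open>Lower bounds from one word of length \<open>n\<close> that is not a combination of
  shorter ones\<close>

context
  fixes S :: "'a set" and y :: "nat \<Rightarrow> 'a" and g :: "nat \<Rightarrow> z3" and n :: nat and t :: "nat tree"
    and r :: z3
  assumes flex: "descendingly_flexible"
    and y: "\<And>i. y i \<in> \<L> 1 S"
    and t: "leaves r t = tag g {0..<n}" "ev y t \<notin> \<L> (n - 1) S"
begin

lemma deg_t: "deg t = n"
  using size_leaves[of r t] t(1) by (simp add: size_tag)

lemma adm_T: "adm r (tag g {0..<n})"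
  using adm_leaves[of r t] t(1) by simp

lemma dim_top_level_ge_1: "1 \<le> m \<Longrightarrow> m \<le> n \<Longrightarrow> dim (\<L> (m - 1) S) + 1 \<le> dim (\<L> m S)"
  using dim_level_ge_1[of y S t m, OF flex y] t(2) deg_t by simp

text \<open>If separation failed, \<open>J - I\<close> would be a single leaf, and every leaf
  without the root label would be this one or the only element of \<open>I - J\<close>; that allows
  at most two such leaves.\<close>

lemma dim_level_many_nonroot:
  assumes "3 \<le> card {i \<in> {0..<n}. g i \<noteq> r}" "1 \<le> m"
  shows "dim (\<L> (m - 1) S) + card {I \<in> Pow {0..<n}. card I = m \<and> adm r (tag g I) \<and>
      (I = {0..<n} \<or> (\<exists>p\<in>{0..<n} - I. g p \<noteq> r))} \<le> dim (\<L> m S)"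
proof (rule dim_level[where y = y and t = t and g = g and h = n and v = r and r = r,
      OF flex y _ t(1) _ _ assms(2)])
  show "ev y t \<notin> \<L> (deg t - 1) S" using t(2) deg_t by simp
  let ?T = "{0..<n}"
  let ?N = "{i \<in> ?T. g i \<noteq> r}"
  fix I J
  assume "I \<in> {I \<in> Pow ?T. card I = m \<and> adm r (tag g I) \<and> (I = ?T \<or> (\<exists>p\<in>?T - I. g p \<noteq> r))}"
    and "J \<in> {I \<in> Pow ?T. card I = m \<and> adm r (tag g I) \<and> (I = ?T \<or> (\<exists>p\<in>?T - I. g p \<noteq> r))}"
    and "I \<noteq> J"
  then have IJ: "I \<subseteq> ?T" "J \<subseteq> ?T" "card I = card J" "I \<noteq> J" by auto
  then have fin: "finite I" "finite J" using finite_subset by blast+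
  have "J - I \<noteq> {}" using IJ fin by (metis Diff_eq_empty_iff card_subset_eq)
  then obtain x where x: "x \<in> J - I" by blast
  show "\<exists>x\<in>J - I. g x = r \<or> (\<exists>p\<in>J \<union> (?T - I) - {x}. g p \<noteq> r)"
  proof (rule ccontr)
    assume neg: "\<not> ?thesis"
    then have "J - I \<subseteq> {x}" using x by blast
    moreover have "card (I - J) = card (J - I)"
      using IJ(3) fin by (simp add: card_Diff_subset_Int Int_commute)
    ultimately have "card (I - J) \<le> 1" using card_mono[of "{x}" "J - I"] by simp
    moreover have "?N \<subseteq> insert x (I - J)" using neg x by blast
    ultimately have "card ?N \<le> 2"
      using card_mono[of "insert x (I - J)" ?N] card_insert_le_m1[of 2 "I - J" x] fin by simp
    then show False using assms(1) by simp
  qed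
qed auto

text \<open>Parity makes the number of leaves without the root label even, and the degenerate clause
  makes it positive.\<close>

lemma few_nonroot:
  assumes "card {i \<in> {0..<n}. g i \<noteq> r} \<le> 2" "2 \<le> n"
  shows "card {i \<in> {0..<n}. g i = r} = n - 2" "card {i \<in> {0..<n}. g i \<noteq> r} = 2"
proof -
  let ?T = "{0..<n}"
  have s: "n = card {i \<in> ?T. g i = r} + cnt (nx r) (tag g ?T) + cnt (nx (nx r)) (tag g ?T)"
    using size_eq_cnt[of "tag g ?T" r] by (simp add: size_tag cnt_tag)
  have "card ?T = card ({i \<in> ?T. g i = r} \<union> {i \<in> ?T. g i \<noteq> r})"
    by (rule arg_cong[of _ _ card]) auto
  also have "\<dots> = card {i \<in> ?T. g i = r} + card {i \<in> ?T. g i \<noteq> r}"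
    by (rule card_Un_disjoint) auto
  finally have c: "n = card {i \<in> ?T. g i = r} + card {i \<in> ?T. g i \<noteq> r}" by simp
  have "card {i \<in> ?T. g i \<noteq> r} = cnt (nx r) (tag g ?T) + cnt (nx (nx r)) (tag g ?T)"
    using c s by linarith
  moreover have "even (cnt (nx r) (tag g ?T) + cnt (nx (nx r)) (tag g ?T))"
    using adm_T unfolding adm_def by auto
  moreover have "cnt (nx r) (tag g ?T) + cnt (nx (nx r)) (tag g ?T) \<noteq> 0"
    using adm_T s assms(2) cnt_tag[of ?T r g] unfolding adm_def by auto
  moreover have "even x \<Longrightarrow> x \<noteq> 0 \<Longrightarrow> x \<le> 2 \<Longrightarrow> x = 2" for x :: nat by presburger
  ultimately show c2: "card {i \<in> ?T. g i \<noteq> r} = 2" using assms(1) by metis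
  show "card {i \<in> ?T. g i = r} = n - 2" using c c2 by simp
qed

text \<open>Each set consists of a fixed leaf \<open>a\<close> without the root label and
  \<open>m - 1\<close> root-labelled leaves. Different sets differ in a root-labelled leaf, whose
  repetition always lowers the degree.\<close>

lemma dim_level_few_nonroot:
  assumes few: "card {i \<in> {0..<n}. g i \<noteq> r} \<le> 2" and "2 \<le> n" "1 \<le> m"
  shows "dim (\<L> (m - 1) S) + (n - 2 choose (m - 1)) \<le> dim (\<L> m S)"
proof -
  let ?T = "{0..<n}"
  let ?R = "{i \<in> ?T. g i = r}"
  let ?B = "{B. B \<subseteq> ?R \<and> card B = m - 1}"
  note cards = few_nonroot[OF few assms(2)]
  obtain a where a: "a \<in> ?T" "g a \<noteq> r"
    using cards(2) by (metis (mono_tags, lifting) card.empty empty_Collect_eq zero_neq_numeral)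
  \<comment> \<open>For odd \<open>m\<close> the root-labelled leaves pair up and \<open>I\<close>
    has root label \<open>g a\<close>; for even \<open>m\<close> one is left over and parity demands
    the third label. Either way the hole is not labelled \<open>r\<close>.\<close>
  obtain v where v: "v \<noteq> r" "v = g a \<longleftrightarrow> odd m"
  proof (cases rule: z3_cases[of "g a" r])
    case 2
    then show ?thesis using that[of "if odd m then nx r else nx (nx r)"] by auto
  next
    case 3
    then show ?thesis using that[of "if odd m then nx (nx r) else nx r"] by auto
  qed (use a in simp)
  have B: "finite B" "a \<notin> B" if "B \<in> ?B" for B
    using that a finite_subset[of B ?R] by auto
  have "card (insert a ` ?B) = card ?B"
  proof (rule card_image, rule inj_onI)
    fix B C assume "B \<in> ?B" "C \<in> ?B" "insert a B = insert a C"
    then show "B = C" using B by (metis insert_ident)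
  qed
  also have "\<dots> = (n - 2 choose (m - 1))"
    using n_subsets[of ?R "m - 1"] cards(1) by simp
  finally have card: "card (insert a ` ?B) = (n - 2 choose (m - 1))" .
  have "dim (\<L> (m - 1) S) + card (insert a ` ?B) \<le> dim (\<L> m S)"
  proof (rule dim_level[where y = y and t = t and g = g and h = n and v = v and r = r,
        OF flex y _ t(1) _ _ assms(3)])
    show "ev y t \<notin> \<L> (deg t - 1) S" using t(2) deg_t by simp
    fix I assume "I \<in> insert a ` ?B"
    then obtain B' where I: "I = insert a B'" "B' \<in> ?B" by blast
    have zero: "cnt c (tag g B') = (if c = r then m - 1 else 0)" for c
    proof -
      have "{i \<in> B'. g i = c} = (if c = r then B' else {})" using I(2) by auto
      then show ?thesis using B(1)[OF I(2)] I(2) by (simp add: cnt_tag)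
    qed
    have "adm v (tag g I)"
      using B[OF I(2)] v a(2) assms(3) unfolding I(1) adm_def
      by (cases rule: z3_cases[of v r]; cases rule: z3_cases[of "g a" r]; cases "odd m")
        (auto simp: zero)
    then show "I \<subseteq> ?T \<and> card I = m \<and> adm v (tag g I) \<and>
        (v \<noteq> r \<or> I = ?T \<or> (\<exists>p\<in>?T - I. g p \<noteq> r))"
      using I B[OF I(2)] a v(1) assms(3) by auto
    fix J assume "J \<in> insert a ` ?B" "I \<noteq> J"
    then obtain C where J: "J = insert a C" "C \<in> ?B" by blast
    have "C - B' \<noteq> {}"
      using I J \<open>I \<noteq> J\<close> B by (metis (mono_tags, lifting) Diff_eq_empty_iff card_subset_eq mem_Collect_eq)
    then obtain x where "x \<in> C - B'" by blast
    then show "\<exists>x\<in>J - I. g x = r \<or> (\<exists>p\<in>J \<union> (?T - I) - {x}. g p \<noteq> r)"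
      using I J a by auto
  qed auto
  then show ?thesis unfolding card .
qed

text \<open>Summing \<open>card_good_subsets\<close> over all sizes gives the bound, with
  \<open>k = n - 4\<close> as the worst case. For \<open>n = 5\<close> it yields only 8; the ninth
  dimension comes from level 4, where no set is counted.\<close>

lemma dim_bound_many_nonroot:
  assumes many: "3 \<le> card {i \<in> {0..<n}. g i \<noteq> r}" and n: "5 \<le> n"
  shows "dim (\<L> 0 S) + (if n = 5 then 9 else 3 * 2 ^ (n - 4) + n - 3) \<le> dim (\<L> n S)"
proof -
  let ?T = "{0..<n}"
  let ?k = "card {i \<in> ?T. g i = r}"
  let ?good = "\<lambda>I. adm r (tag g I) \<and> (I = ?T \<or> (\<exists>p\<in>?T - I. g p \<noteq> r))"
  let ?F = "{I \<in> Pow ?T. ?good I}"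
  define f where "f m = card {I \<in> Pow ?T. card I = m \<and> ?good I}" for m
  have s: "n = ?k + cnt (nx r) (tag g ?T) + cnt (nx (nx r)) (tag g ?T)"
    using size_eq_cnt[of "tag g ?T" r] by (simp add: size_tag cnt_tag)
  have "card ?T = card ({i \<in> ?T. g i = r} \<union> {i \<in> ?T. g i \<noteq> r})"
    by (rule arg_cong[of _ _ card]) auto
  also have "\<dots> = ?k + card {i \<in> ?T. g i \<noteq> r}"
    by (rule card_Un_disjoint) auto
  finally have c: "n = ?k + card {i \<in> ?T. g i \<noteq> r}" by simp
  have "even (cnt (nx r) (tag g ?T) + cnt (nx (nx r)) (tag g ?T))"
    using adm_T unfolding adm_def by auto
  moreover have "n - ?k = cnt (nx r) (tag g ?T) + cnt (nx (nx r)) (tag g ?T)"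
    using s by linarith
  ultimately have even: "even (n - ?k)" by simp
  moreover have "n - ?k = card {i \<in> ?T. g i \<noteq> r}" using c by linarith
  moreover have "even x \<Longrightarrow> 3 \<le> x \<Longrightarrow> 4 \<le> x" for x :: nat by presburger
  ultimately have "4 \<le> card {i \<in> ?T. g i \<noteq> r}" using many by metis
  then have k: "?k \<le> n - 4" using c by linarith
  have nonroot: "\<exists>p\<in>?T. g p \<noteq> r"
  proof (rule ccontr)
    assume "\<not> ?thesis"
    then have "{i \<in> ?T. g i \<noteq> r} = {}" by blast
    with many show False by (simp only: card.empty)
  qed
  have F: "2 ^ (n - 2) + ?k + 1 \<le> card ?F + 2 ^ ?k"
    using card_good_subsets[OF _ adm_T _ nonroot] n by simp
  have "f 0 = 0"
  proof -
    have "{I \<in> Pow ?T. card I = 0 \<and> ?good I} = {}"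
      using finite_subset[of _ ?T] by (auto simp: adm_def)
    then show ?thesis unfolding f_def by simp
  qed
  have "(\<Sum>m\<le>n. f m) = card ?F"
    unfolding f_def using sum_card_levels[of ?T ?good] by simp
  then have sum_f: "(\<Sum>m=1..n. f m) = card ?F"
    using \<open>f 0 = 0\<close> by (simp add: sum.atLeast_Suc_atMost atMost_atLeast0)
  \<comment> \<open>The maximum accounts for levels in which no set is counted; they still grow by
    1.\<close>
  have level: "dim (\<L> (m - 1) S) + max 1 (f m) \<le> dim (\<L> m S)" if "1 \<le> m" "m \<le> n" for m
    using dim_top_level_ge_1[OF that] dim_level_many_nonroot[OF many that(1)] unfolding f_def by simp
  have total: "dim (\<L> 0 S) + (\<Sum>m=1..n. max 1 (f m)) \<le> dim (\<L> n S)"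
    by (rule dim_level_sum) (rule level)
  have ge: "card ?F \<le> (\<Sum>m=1..n. max 1 (f m))"
    unfolding sum_f[symmetric] by (rule sum_mono) simp
  show ?thesis
  proof (cases "n = 5")
    case False
    have "2 ^ ?k + (n - 4) \<le> 2 ^ (n - 4) + ?k" by (rule pow2_minus_mono[OF k])
    moreover have "(2::nat) ^ (n - 2) = 4 * 2 ^ (n - 4)"
      using n by (intro pow2_diff_2) simp
    ultimately have "3 * 2 ^ (n - 4) + n - 3 \<le> card ?F" using F n by linarith
    then show ?thesis using total ge unfolding if_not_P[OF False] by linarith
  next
    case True
    have "x \<le> 1 \<Longrightarrow> even (5 - x) \<Longrightarrow> x = 1" for x :: nat by (cases "x = 0") auto
    then have k1: "?k = 1" using k even True by simp
    \<comment> \<open>With a single root-labelled leaf, an admissible set of size 4 must consist of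
      the four other leaves with an odd number labelled \<open>nx r\<close>, but admissibility of
      \<open>?T\<close> makes this number even.\<close>
    have "f 4 = 0"
    proof -
      have False if "I \<subseteq> ?T" "card I = 4" "adm r (tag g I)" for I
      proof -
        have fin: "finite I" using that(1) finite_subset by blast
        let ?b = "cnt (nx r) (tag g ?T)"
        have e: "even ?b" using adm_T k1 cnt_tag[of ?T r g] unfolding adm_def by auto
        have sI: "4 = cnt r (tag g I) + cnt (nx r) (tag g I) + cnt (nx (nx r)) (tag g I)"
          using size_eq_cnt[of "tag g I" r] that(2) fin by (simp add: size_tag)
        note D = cnt_tag_Diff[of ?T I _ g, OF _ that(1), simplified]
        have r1: "cnt r (tag g I) + cnt r (tag g (?T - I)) = 1"
          using D[of r] k1 by (simp add: cnt_tag)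
        have "a + b + c = 4 \<Longrightarrow> a \<le> 1 \<Longrightarrow> (even b \<longleftrightarrow> even c) \<Longrightarrow> (even a \<longleftrightarrow> odd b) \<Longrightarrow>
            odd b \<and> b + c = 4" for a b c :: nat by presburger
        from this[OF sI[symmetric]] have "odd (cnt (nx r) (tag g I))"
          "cnt (nx r) (tag g I) + cnt (nx (nx r)) (tag g I) = 4"
          using r1 that(3) unfolding adm_def by auto
        moreover have "cnt (nx r) (tag g I) \<le> ?b" "cnt (nx (nx r)) (tag g I) \<le> cnt (nx (nx r)) (tag g ?T)"
          using D[of "nx r"] D[of "nx (nx r)"] by simp_all
        moreover have "?b + cnt (nx (nx r)) (tag g ?T) = 4" using s k1 True by linarith
        ultimately have "cnt (nx r) (tag g I) = ?b" by linarith
        then show False using e \<open>odd (cnt (nx r) (tag g I))\<close> by simp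
      qed
      then have "{I \<in> Pow ?T. card I = 4 \<and> ?good I} = {}" by blast
      then show ?thesis unfolding f_def by simp
    qed
    then have "(\<Sum>m=1..n. f m) + 1 \<le> (\<Sum>m=1..n. max 1 (f m))"
      by (simp add: True numeral_eq_Suc)
    moreover have "8 \<le> card ?F" using F k1 True by simp
    ultimately show ?thesis using total sum_f True by simp
  qed
qed

text \<open>The binomial coefficients of the levels below \<open>n\<close> add up to
  \<open>2 ^ (n - 2)\<close>; at level \<open>n\<close> the coefficient vanishes and the general
  growth by 1 is used.\<close>

lemma dim_bound_few_nonroot:
  assumes few: "card {i \<in> {0..<n}. g i \<noteq> r} \<le> 2" and n: "5 \<le> n"
  shows "dim (\<L> 0 S) + (2 ^ (n - 2) + 1) \<le> dim (\<L> n S)"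
proof -
  define f where "f m = (if m = n then 1 else (n - 2 choose (m - 1)))" for m
  have level: "dim (\<L> (m - 1) S) + f m \<le> dim (\<L> m S)" if "1 \<le> m" "m \<le> n" for m
    using dim_top_level_ge_1[OF that] dim_level_few_nonroot[OF few _ that(1)] n unfolding f_def by auto
  have "(\<Sum>m=1..n. f m) = (\<Sum>m=1..n-1. f m) + f n"
    using n by (cases n) auto
  also have "(\<Sum>m=1..n-1. f m) = (\<Sum>m=1..n-1. (n - 2 choose (m - 1)))"
    by (rule sum.cong) (use n in \<open>auto simp: f_def\<close>)
  also have "\<dots> = (\<Sum>m\<le>n-2. (n - 2 choose m))"
    by (rule sum.reindex_bij_witness[of _ Suc "\<lambda>m. m - 1"]) (use n in auto)
  also have "\<dots> = 2 ^ (n - 2)" by (rule choose_row_sum)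
  finally have "(\<Sum>m=1..n. f m) = 2 ^ (n - 2) + 1" by (simp add: f_def)
  then show ?thesis using dim_level_sum[of n S f] level by simp
qed

lemma dim_bound_large:
  assumes "5 \<le> n"
  shows "dim (\<L> 0 S) + (if n = 5 then 9 else 3 * 2 ^ (n - 4) + n - 3) \<le> dim (\<L> n S)"
proof (cases "3 \<le> card {i \<in> {0..<n}. g i \<noteq> r}")
  case True
  then show ?thesis using dim_bound_many_nonroot assms by blast
next
  case False
  then have b: "dim (\<L> 0 S) + (2 ^ (n - 2) + 1) \<le> dim (\<L> n S)"
    using dim_bound_few_nonroot assms by simp
  show ?thesis
  proof (cases "n = 5")
    case False
    have "(2::nat) ^ (n - 2) = 4 * 2 ^ (n - 4)"
      using assms by (intro pow2_diff_2) simp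
    moreover have "n - 4 < 2 ^ (n - 4)" by (rule less_exp)
    ultimately have "3 * 2 ^ (n - 4) + n - 3 \<le> (2::nat) ^ (n - 2) + 1" using assms by linarith
    then show ?thesis using b unfolding if_not_P[OF False] by linarith
  qed (use b in simp)
qed

text \<open>Levels 1 and 2 grow by 2 each if \<open>n \<ge> 3\<close>, level 3 by 2 if
  \<open>n = 4\<close>, and the top level by 1; this gives 5 and 7.\<close>

lemma dim_bound_small:
  assumes "1 \<le> n" "n \<le> 4"
  shows "dim (\<L> 0 S) + (if n \<le> 2 then n else 2 * n - 1) \<le> dim (\<L> n S)"
proof -
  note one = dim_top_level_ge_1
  have low: "dim (\<L> 0 S) + 2 \<le> dim (\<L> 1 S) \<and> dim (\<L> 1 S) + 2 \<le> dim (\<L> 2 S)" if n3: "3 \<le> n"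
  proof -
    obtain u where u: "deg u = 3" "ev y u \<notin> \<L> 2 S"
      using nonzero_subtree[where y = y and S = S and t = t and m = 3, OF flex y] t(2) deg_t n3 by auto
    obtain p q where pq: "u = Node p q" using u by (cases u) auto
    then have "deg p + deg q = 3" using u by simp
    then consider "deg p = 1" "deg q = 2" | "deg p = 2" "deg q = 1"
      using deg_pos[of p] deg_pos[of q] by arith
    then show ?thesis
    proof cases
      case 1
      obtain a where a: "p = Leaf a"
        using leaves_eq_single 1(1) by (metis size_leaves size_1_singleton_mset)
      obtain q1 q2 where q: "q = Node q1 q2" using 1 by (cases q) auto
      then have "deg q1 + deg q2 = 2" using 1 by simp
      then have "deg q1 = 1" "deg q2 = 1" using deg_pos[of q1] deg_pos[of q2] by arith+
      then have "ev y q1 \<in> \<L> 1 S" "ev y q2 \<in> \<L> 1 S"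
        using ev_in_\<L>[of y S q1, OF y] ev_in_\<L>[of y S q2, OF y] by simp_all
      then show ?thesis
        using dim_levels_of_degree_3[OF flex y[of a], of "ev y q1" "ev y q2"] u(2) by (simp add: pq a q)
    next
      case 2
      obtain a where a: "q = Leaf a"
        using leaves_eq_single 2(2) by (metis size_leaves size_1_singleton_mset)
      obtain p1 p2 where p: "p = Node p1 p2" using 2 by (cases p) auto
      then have "deg p1 + deg p2 = 2" using 2 by simp
      then have "deg p1 = 1" "deg p2 = 1" using deg_pos[of p1] deg_pos[of p2] by arith+
      then have "ev y p1 \<in> \<L> 1 S" "ev y p2 \<in> \<L> 1 S"
        using ev_in_\<L>[of y S p1, OF y] ev_in_\<L>[of y S p2, OF y] by simp_all
      then show ?thesis
        using dim_levels_of_degree_3[OF flex _ _ y[of a], of "ev y p1" "ev y p2"] u(2) by (simp add: pq a p)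
    qed
  qed
  consider "n = 1" | "n = 2" | "n = 3" | "n = 4" using assms by linarith
  then show ?thesis
  proof cases
    case 1
    then show ?thesis using one[of 1] by simp
  next
    case 2
    then show ?thesis using one[of 1] one[of 2] by simp
  next
    case 3
    then show ?thesis using low one[of 3] by simp
  next
    case 4
    then have "dim (\<L> 2 S) + 2 \<le> dim (\<L> 3 S)"
      using dim_level_3_of_degree_4[of y S t, OF flex y] t(2) deg_t by simp
    then show ?thesis using low one[of 4] 4 by simp
  qed
qed

end

lemma dim_ge_alg_length:
  assumes flex: "descendingly_flexible" and n: "n = alg_length" "1 \<le> n"
  shows "d0 + (if n \<le> 2 then n else if n \<le> 5 then 2 * n - 1 else 3 * 2 ^ (n - 4) + n - 3) \<le> dim (UNIV :: 'a set)"
proof -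
  have "n \<in> set_length ` {S. generating S}"
    unfolding n alg_length_def by (rule Max_in[OF finite_set_lengths set_lengths_nonempty])
  then obtain S where S: "generating S" "set_length S = n" by blast
  have top: "\<L> n S = UNIV" using \<L>_set_length[of S] S unfolding generating_def by simp
  have neq: "\<L> (n - 1) S \<noteq> UNIV"
    using not_less_Least[of "n - 1" "\<lambda>k. \<L> k S = \<L>_inf S"] S n(2)
    unfolding generating_def set_length_def by auto
  \<comment> \<open>Otherwise level \<open>n - 1\<close> would already be everything, against the
    minimality in \<open>set_length\<close>.\<close>
  have "\<exists>w. word S n w \<and> w \<notin> \<L> (n - 1) S"
  proof (rule ccontr)
    assume neg: "\<not> ?thesis"
    have "words_upto S n \<subseteq> \<L> (n - 1) S"
    proof
      fix w assume "w \<in> words_upto S n"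
      then obtain i where i: "i \<le> n" "word S i w" unfolding words_upto_def by blast
      show "w \<in> \<L> (n - 1) S"
      proof (cases "i = n")
        case True
        then show ?thesis using i neg by blast
      next
        case False
        then show ?thesis using i by (intro word_in_\<L>[of S i]) auto
      qed
    qed
    then have "\<L> n S \<subseteq> \<L> (n - 1) S"
      unfolding \<L>_def[of n] by (intro span_minimal subspace_\<L>)
    then show False using top neq by auto
  qed
  then obtain w where w: "word S n w" "w \<notin> \<L> (n - 1) S" by blast
  \<comment> \<open>Only differences of labels matter, so \<open>Z0\<close> is an arbitrary root
    label.\<close>
  obtain t y g where t: "\<And>i. y i \<in> S" "leaves Z0 t = tag g {0..<n}" "ev y t = w"
    using word_imp_labelled_tree[OF w(1) n(2), of Z0] by metis
  have y: "y i \<in> \<L> 1 S" for i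
    using t(1) word_in_\<L>[OF word_generator] by blast
  have nz: "ev y t \<notin> \<L> (n - 1) S" using t(3) w(2) by simp
  have "d0 \<le> dim (\<L> 0 S)" using d0_le_dim[OF neq] .
  moreover have "dim (\<L> 0 S) +
      (if n \<le> 2 then n else if n \<le> 5 then 2 * n - 1 else 3 * 2 ^ (n - 4) + n - 3) \<le> dim (\<L> n S)"
  proof (cases "n \<le> 4")
    case True
    then show ?thesis using dim_bound_small[of y S Z0 t g n, OF flex y t(2) nz n(2)] by (auto split: if_splits)
  next
    case False
    then show ?thesis using dim_bound_large[of y S Z0 t g n, OF flex y t(2) nz] by (auto split: if_splits)
  qed
  ultimately show ?thesis unfolding top by linarith
qed

end

theorem theorem5p17:
  fixes scale :: "'f::field \<Rightarrow> 'a::ab_group_add \<Rightarrow> 'a"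
    and mult :: "'a \<Rightarrow> 'a \<Rightarrow> 'a"
    and Basis :: "'a set"
    and n :: nat
  assumes "fin_dim_nonassoc_algebra scale mult Basis"
    and "nonassoc_algebra.descendingly_flexible scale mult"
    and "n = nonassoc_algebra.alg_length scale mult"
    and "1 \<le> n"
  shows "int (vector_space.dim scale (UNIV :: 'a set)) - int (nonassoc_algebra.d0 mult) \<ge>
           (if n \<le> 2 then int n
            else if n \<le> 5 then 2 * int n - 1
            else 3 * 2 ^ (n - 4) + int n - 3)"
proof -
  interpret fin_dim_nonassoc_algebra scale mult Basis by (rule assms(1))
  let ?b = "if n \<le> 2 then n else if n \<le> 5 then 2 * n - 1 else 3 * 2 ^ (n - 4) + n - 3"
  \<comment> \<open>The subtractions in \<open>?b\<close> never truncate, since they occur only for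
    \<open>n \<ge> 3\<close>.\<close>
  have "int ?b = (if n \<le> 2 then int n else if n \<le> 5 then 2 * int n - 1 else 3 * 2 ^ (n - 4) + int n - 3)"
    by (simp add: of_nat_diff)
  moreover have "int d0 + int ?b \<le> int (dim UNIV)"
    using dim_ge_alg_length[OF assms(2-4)] by (metis of_nat_add of_nat_le_iff)
  ultimately show ?thesis by linarith
qed

end
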